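(* For every odd integer $k\ge 1$, $$D^{\mathrm{VR}}_{2k+2,k}(\mathbb S^1)=\left\{(t_b,t_d)\in\mathbb R^2:\ (k+1)(\pi-t_b)\le t_d\ \text{ and }\ \frac{k}{k+1}\pi\le t_b<t_d\le\pi\right\}.$$
   Context: $\mathbb S^1=[0,2\pi]/(0\sim 2\pi)$ with the geodesic distance $d(x,y)=\min(|x-y|,2\pi-|x-y|)$. For a finite metric space $Y$ and $r\ge 0$, $\mathrm{VR}_r(Y)$ is the simplicial complex of nonempty subsets $\sigma\subset Y$ with $\mathrm{diam}(\sigma)\le r$. With a fixed coefficient field $\mathbb F$, the persistence module $r\mapsto\widetilde H_k(\mathrm{VR}_r(Y);\mathbb F)$ (reduced homology) decomposes into finitely many interval modules on intervals $[b_\alpha,d_\alpha)$, and $\mathrm{dgm}_k^{\mathrm{VR}}(Y)$ is the multiset of points $(b_\alpha,d_\alpha)$. If $|Y|\le 2k+2$ this diagram has at most one point. For a metric space $X$, the principal persistence set $D^{\mathrm{VR}}_{2k+2,k}(X)$ is identified with the subset of $\mathbb R^2$ of all $(t_b,t_d)$ such that $\mathrm{dgm}_k^{\mathrm{VR}}(X')=\{(t_b,t_d)\}$ for some $X'\subset X$ with $|X'|\le 2k+2$ (the empty diagram, which always arises, is omitted by convention). *)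

theory Defs
  imports Complex_Main "HOL-Library.Poly_Mapping" "HOL-Library.Multiset" "HOL-Library.FuncSet"
begin

section \<open>Vector spaces and persistence modules\<close>

record ('f, 'v) vspace =
  vcarrier :: "'v set"
  vadd :: "'v \<Rightarrow> 'v \<Rightarrow> 'v"
  vscale :: "'f \<Rightarrow> 'v \<Rightarrow> 'v"

definition linear_iso :: "('f, 'v) vspace \<Rightarrow> ('f, 'w) vspace \<Rightarrow> ('v \<Rightarrow> 'w) \<Rightarrow> bool" where
  "linear_iso V W \<phi> \<longleftrightarrow>
     bij_betw \<phi> (vcarrier V) (vcarrier W) \<and>
     (\<forall>x\<in>vcarrier V. \<forall>y\<in>vcarrier V. \<phi> (vadd V x y) = vadd W (\<phi> x) (\<phi> y)) \<and>
     (\<forall>a. \<forall>x\<in>vcarrier V. \<phi> (vscale V a x) = vscale W a (\<phi> x))"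

text \<open>A persistence module over the index poset of nonnegative reals: \<open>pspace V r\<close> is the space at
  \<open>r\<close>, and \<open>pmap V r s\<close> is the structure map from \<open>r\<close> to \<open>s\<close>. Both are only
  meaningful for \<open>0 \<le> r \<le> s\<close>.\<close>

record ('f, 'v) pers_module =
  pspace :: "real \<Rightarrow> ('f, 'v) vspace"
  pmap :: "real \<Rightarrow> real \<Rightarrow> 'v \<Rightarrow> 'v"

definition pers_isomorphic :: "('f, 'v) pers_module \<Rightarrow> ('f, 'w) pers_module \<Rightarrow> bool" where
  "pers_isomorphic V W \<longleftrightarrow> (\<exists>\<phi>.
     (\<forall>r\<ge>0. linear_iso (pspace V r) (pspace W r) (\<phi> r)) \<and>
     (\<forall>r s. 0 \<le> r \<longrightarrow> r \<le> s \<longrightarrow>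
        (\<forall>x\<in>vcarrier (pspace V r). \<phi> s (pmap V r s x) = pmap W r s (\<phi> r x))))"

definition interval_module :: "real \<Rightarrow> real \<Rightarrow> ('f::field, 'f) pers_module" where
  "interval_module b d =
     \<lparr> pspace = (\<lambda>r. \<lparr> vcarrier = (if r \<in> {b..<d} then UNIV else {0}), vadd = (+), vscale = (*) \<rparr>),
       pmap = (\<lambda>r s x. if r \<in> {b..<d} \<and> s \<in> {b..<d} then x else 0) \<rparr>"

definition direct_sum :: "('f, 'v) pers_module list \<Rightarrow> ('f, nat \<Rightarrow> 'v) pers_module" where
  "direct_sum Vs =
     \<lparr> pspace = (\<lambda>r.
         \<lparr> vcarrier = (\<Pi>\<^sub>E i\<in>{..<length Vs}. vcarrier (pspace (Vs ! i) r)),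
           vadd = (\<lambda>x y. \<lambda>i\<in>{..<length Vs}. vadd (pspace (Vs ! i) r) (x i) (y i)),
           vscale = (\<lambda>a x. \<lambda>i\<in>{..<length Vs}. vscale (pspace (Vs ! i) r) a (x i)) \<rparr>),
       pmap = (\<lambda>r s x. \<lambda>i\<in>{..<length Vs}. pmap (Vs ! i) r s (x i)) \<rparr>"

text \<open>\<open>has_dgm V M\<close>: \<open>M\<close> is the persistence diagram of \<open>V\<close>. This is a relation, since not every
  \<open>V\<close> is a finite sum of interval modules with finite endpoints; when it is, the multiset \<open>M\<close> is
  unique by the Krull--Remak--Schmidt--Azumaya theorem.\<close>

definition has_dgm :: "('f::field, 'v) pers_module \<Rightarrow> (real \<times> real) multiset \<Rightarrow> bool" where
  "has_dgm V M \<longleftrightarrow> (\<exists>Is. mset Is = M \<and> (\<forall>(b, d)\<in>set Is. 0 \<le> b \<and> b < d) \<and>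
     pers_isomorphic V (direct_sum (map (\<lambda>(b, d). interval_module b d) Is)))"


section \<open>Reduced simplicial homology over a field\<close>

text \<open>A simplicial complex is given by its set of nonempty finite simplices. A simplex is oriented by
  the linear order on vertices; the homology does not depend on this order. The vertex list of
  \<open>\<sigma>\<close> being \<open>v\<^sub>0 < \<dots> < v\<^sub>k\<close>, the exponent of \<open>-1\<close> below is the position of
  \<open>v\<close> in it. A vertex has boundary \<open>1 \<cdot> {}\<close>, so the empty set spans degree \<open>-1\<close> and
  \<open>bdry\<close> on \<open>0\<close>-chains is the augmentation: the homology below is reduced.\<close>

definition chains :: "'a set set \<Rightarrow> nat \<Rightarrow> ('a set \<Rightarrow>\<^sub>0 'f::field) set" where
  "chains K k = {c. Poly_Mapping.keys c \<subseteq> {\<sigma>\<in>K. card \<sigma> = k + 1}}"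

definition bdry :: "('a::linorder set \<Rightarrow>\<^sub>0 'f::field) \<Rightarrow> ('a set \<Rightarrow>\<^sub>0 'f)" where
  "bdry c = (\<Sum>\<sigma>\<in>Poly_Mapping.keys c. \<Sum>v\<in>\<sigma>.
     Poly_Mapping.single (\<sigma> - {v}) ((- 1) ^ card {w\<in>\<sigma>. w < v} * Poly_Mapping.lookup c \<sigma>))"

definition cycles :: "'a::linorder set set \<Rightarrow> nat \<Rightarrow> ('a set \<Rightarrow>\<^sub>0 'f::field) set" where
  "cycles K k = {c\<in>chains K k. bdry c = 0}"

definition boundaries :: "'a::linorder set set \<Rightarrow> nat \<Rightarrow> ('a set \<Rightarrow>\<^sub>0 'f::field) set" where
  "boundaries K k = bdry ` chains K (k + 1)"

text \<open>Elements of the homology are the cosets of \<open>boundaries K k\<close> in \<open>cycles K k\<close>. In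
  \<open>vscale\<close>, adding the boundaries only matters for the scalar \<open>0\<close>.\<close>

definition reduced_homology ::
    "'a::linorder set set \<Rightarrow> nat \<Rightarrow> ('f::field, ('a set \<Rightarrow>\<^sub>0 'f) set) vspace" where
  "reduced_homology K k =
     \<lparr> vcarrier = {{z + b | b. b \<in> boundaries K k} | z. z \<in> cycles K k},
       vadd = (\<lambda>X Y. {x + y | x y. x \<in> X \<and> y \<in> Y}),
       vscale = (\<lambda>a X. {Poly_Mapping.map ((*) a) x + b | x b. x \<in> X \<and> b \<in> boundaries K k}) \<rparr>"


section \<open>Vietoris--Rips persistence and principal persistence sets\<close>

text \<open>Metric spaces are given by a point set together with a distance function.\<close>

definition diam :: "('a \<Rightarrow> 'a \<Rightarrow> real) \<Rightarrow> 'a set \<Rightarrow> real" where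
  "diam d \<sigma> = Max {d x y | x y. x \<in> \<sigma> \<and> y \<in> \<sigma>}"

definition VR :: "('a \<Rightarrow> 'a \<Rightarrow> real) \<Rightarrow> 'a set \<Rightarrow> real \<Rightarrow> 'a set set" where
  "VR d Y r = {\<sigma>. \<sigma> \<subseteq> Y \<and> finite \<sigma> \<and> \<sigma> \<noteq> {} \<and> diam d \<sigma> \<le> r}"

text \<open>The structure map is induced by the inclusion of \<open>VR d Y r\<close> in \<open>VR d Y s\<close>: it sends the
  class of a cycle modulo the boundaries at \<open>r\<close> to its class modulo the boundaries at \<open>s\<close>.\<close>

definition VR_module ::
    "nat \<Rightarrow> ('a::linorder \<Rightarrow> 'a \<Rightarrow> real) \<Rightarrow> 'a set \<Rightarrow> ('f::field, ('a set \<Rightarrow>\<^sub>0 'f) set) pers_module" where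
  "VR_module k d Y =
     \<lparr> pspace = (\<lambda>r. reduced_homology (VR d Y r) k),
       pmap = (\<lambda>r s X. {x + b | x b. x \<in> X \<and> b \<in> boundaries (VR d Y s) k}) \<rparr>"

definition principal_persistence_set ::
    "'f::field itself \<Rightarrow> nat \<Rightarrow> ('a::linorder \<Rightarrow> 'a \<Rightarrow> real) \<Rightarrow> 'a set \<Rightarrow> (real \<times> real) set" where
  "principal_persistence_set F k d X =
     {(tb, td). \<exists>X'. X' \<subseteq> X \<and> finite X' \<and> card X' \<le> 2 * k + 2 \<and>
        has_dgm (VR_module k d X' :: ('f, ('a set \<Rightarrow>\<^sub>0 'f) set) pers_module) {#(tb, td)#}}"


section \<open>The geodesic circle\<close>

text \<open>Points of the quotient of \<open>[0, 2\<pi>]\<close> by \<open>0 \<sim> 2\<pi>\<close> are represented by their unique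
  representatives in \<open>[0, 2\<pi>)\<close>.\<close>

definition circle :: "real set" where
  "circle = {0..<2 * pi}"

definition circle_dist :: "real \<Rightarrow> real \<Rightarrow> real" where
  "circle_dist x y = min \<bar>x - y\<bar> (2 * pi - \<bar>x - y\<bar>)"

end

theory Submission
  imports Defs
begin

text \<open>The part of the Mayer--Vietoris sequence given by the star and the deletion of a vertex shows, by
  induction, that a clique complex on at most \<open>2k + 2\<close> vertices has trivial reduced homology in degree
  \<open>k\<close> unless it has exactly \<open>2k + 2\<close> vertices and each of them has exactly one non-neighbour; then it is
  the boundary of a cross-polytope, and the homology is one-dimensional. So a one-point diagram
  \<open>(tb, td)\<close> means that the points are matched in pairs at distance at least \<open>td\<close>, that all other
  distances are at most \<open>tb\<close>, and that both bounds are attained. On the circle the chords of the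
  matching cross pairwise, so the \<open>i\<close>-th point is matched with the \<open>(i + k + 1)\<close>-st, and the two
  inequalities follow by walking around the circle in steps of \<open>k\<close> points. A two-parameter
  deformation of the regular polygon attains all values that they allow.\<close>

section \<open>Clique complexes with few vertices\<close>

definition face_sign :: "'a::linorder \<Rightarrow> 'a set \<Rightarrow> 'f::field" where
  "face_sign v \<sigma> = (- 1) ^ card {w\<in>\<sigma>. w < v}"

text \<open>The coefficient of \<open>\<tau>\<close> in the simplicial boundary of \<open>c\<close>,
  collected over the cofaces of \<open>\<tau>\<close>. Chains are plain functions on sets, so they
  can be cut and recombined pointwise; the case \<open>\<tau> = {}\<close> is the
  augmentation.\<close>

definition boundary_sum :: "'a::linorder set \<Rightarrow> ('a set \<Rightarrow> 'f::field) \<Rightarrow> 'a set \<Rightarrow> 'f" where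
  "boundary_sum U c \<tau> =
     (if \<tau> \<subseteq> U then \<Sum>u\<in>U - \<tau>. face_sign u \<tau> * c (insert u \<tau>) else 0)"

text \<open>The join of the vertex \<open>v\<close> with \<open>b\<close>, with the sign that moves
  \<open>v\<close> to the front of the vertex order. It is meant for \<open>b\<close> vanishing on
  sets that contain \<open>v\<close>.\<close>

definition cone :: "'a::linorder \<Rightarrow> ('a set \<Rightarrow> 'f::field) \<Rightarrow> 'a set \<Rightarrow> 'f" where
  "cone v b \<sigma> = (if v \<in> \<sigma> then face_sign v (\<sigma> - {v}) * b (\<sigma> - {v}) else 0)"

lemma face_sign_square [simp]: "face_sign v \<sigma> * face_sign v \<sigma> = (1 :: 'f::field)"
  by (simp add: face_sign_def flip: power_mult_distrib)

lemma face_sign_nonzero [simp]: "face_sign v \<sigma> \<noteq> (0 :: 'f::field)"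
  by (simp add: face_sign_def)

lemma face_sign_insert:
  assumes "finite \<sigma>" "u \<notin> \<sigma>"
  shows "face_sign v (insert u \<sigma>) = (if u < v then - face_sign v \<sigma> else (face_sign v \<sigma> :: 'f::field))"
proof (cases "u < v")
  case True
  then have "{w \<in> insert u \<sigma>. w < v} = insert u {w \<in> \<sigma>. w < v}" by auto
  then show ?thesis using True assms by (simp add: face_sign_def)
next
  case False
  then have "{w \<in> insert u \<sigma>. w < v} = {w \<in> \<sigma>. w < v}" by auto
  then show ?thesis using False by (simp add: face_sign_def)
qed

text \<open>Exactly one of \<open>u < v\<close> and \<open>v < u\<close> holds, so exactly one of
  the two signs changes when the other vertex is inserted.\<close>

lemma face_sign_swap:
  assumes "finite \<sigma>" "u \<notin> \<sigma>" "v \<notin> \<sigma>" "u \<noteq> v"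
  shows "face_sign u (insert v \<sigma>) * face_sign v (insert u \<sigma>)
    = - (face_sign v \<sigma> * face_sign u \<sigma> :: 'f::field)"
  using assms by (cases "u < v") (auto simp: face_sign_insert)

lemma boundary_sum_add:
  "boundary_sum U (\<lambda>\<sigma>. a \<sigma> + b \<sigma>) \<tau> = boundary_sum U a \<tau> + boundary_sum U b \<tau>"
  by (simp add: boundary_sum_def algebra_simps sum.distrib)

lemma boundary_sum_diff:
  "boundary_sum U (\<lambda>\<sigma>. a \<sigma> - b \<sigma>) \<tau> = boundary_sum U a \<tau> - boundary_sum U b \<tau>"
  by (simp add: boundary_sum_def algebra_simps sum_subtractf)

lemma boundary_sum_avoid:
  assumes "\<And>\<sigma>. v \<in> \<sigma> \<Longrightarrow> c \<sigma> = 0" "v \<in> \<tau>"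
  shows "boundary_sum U c \<tau> = 0"
  using assms by (simp add: boundary_sum_def)

text \<open>The join formula: dropping the apex gives back \<open>b\<close>, and dropping any other
  vertex keeps the apex and reverses the sign.\<close>

lemma boundary_sum_cone:
  assumes "finite U" "v \<in> U" and b: "\<And>\<sigma>. v \<in> \<sigma> \<Longrightarrow> b \<sigma> = 0" "\<And>\<sigma>. \<not> \<sigma> \<subseteq> U \<Longrightarrow> b \<sigma> = 0"
  shows "boundary_sum U (cone v b) \<tau> = b \<tau> - cone v (boundary_sum U b) \<tau>"
proof (cases "\<tau> \<subseteq> U")
  case False
  then have "\<not> \<tau> - {v} \<subseteq> U" using assms(2) by blast
  then show ?thesis using False b by (simp add: boundary_sum_def cone_def)
next
  case True
  then have fin: "finite \<tau>" using assms(1) finite_subset by blast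
  show ?thesis
  proof (cases "v \<in> \<tau>")
    case False
    have "boundary_sum U (cone v b) \<tau>
        = (\<Sum>u\<in>U - \<tau>. if u = v then face_sign u \<tau> * cone v b (insert u \<tau>) else 0)"
      unfolding boundary_sum_def using True False by (auto intro!: sum.cong simp: cone_def)
    also have "\<dots> = face_sign v \<tau> * cone v b (insert v \<tau>)"
      using assms(1,2) False by simp
    also have "\<dots> = b \<tau>" using False by (simp add: cone_def flip: mult.assoc)
    finally show ?thesis using False by (simp add: cone_def)
  next
    case v: True
    define \<rho> where "\<rho> = \<tau> - {v}"
    have \<tau>: "\<tau> = insert v \<rho>" "v \<notin> \<rho>" "finite \<rho>" using v fin by (auto simp: \<rho>_def)
    have "boundary_sum U b \<rho> = (\<Sum>u\<in>U - \<rho>. face_sign u \<rho> * b (insert u \<rho>))"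
      using True \<tau> by (simp add: boundary_sum_def)
    \<comment> \<open>The term for \<open>u = v\<close> drops out because \<open>b\<close> vanishes
      on sets containing \<open>v\<close>.\<close>
    also have "\<dots> = (\<Sum>u\<in>U - \<tau>. face_sign u \<rho> * b (insert u \<rho>))"
      using assms(1) \<tau> b(1) by (intro sum.mono_neutral_right) auto
    finally have D: "boundary_sum U b \<rho> = (\<Sum>u\<in>U - \<tau>. face_sign u \<rho> * b (insert u \<rho>))" .
    have "boundary_sum U (cone v b) \<tau>
        = (\<Sum>u\<in>U - \<tau>. - (face_sign v \<rho> * (face_sign u \<rho> * b (insert u \<rho>))))"
      unfolding boundary_sum_def using True
    proof (simp, intro sum.cong refl)
      fix u assume u: "u \<in> U - \<tau>"
      then have *: "insert u \<tau> - {v} = insert u \<rho>" "u \<notin> \<rho>" "u \<noteq> v" using \<tau> by auto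
      have "face_sign u \<tau> * cone v b (insert u \<tau>)
          = (face_sign u (insert v \<rho>) * face_sign v (insert u \<rho>)) * b (insert u \<rho>)"
        using * \<tau>(1) by (simp add: cone_def)
      also have "\<dots> = - (face_sign v \<rho> * (face_sign u \<rho> * b (insert u \<rho>)))"
        by (simp add: face_sign_swap[OF \<tau>(3) *(2) \<tau>(2) *(3)] mult.assoc)
      finally show "face_sign u \<tau> * cone v b (insert u \<tau>) = - (face_sign v \<rho> * (face_sign u \<rho> * b (insert u \<rho>)))" .
    qed
    also have "\<dots> = - (face_sign v \<rho> * boundary_sum U b \<rho>)"
      by (simp add: D sum_negf sum_distrib_left)
    finally show ?thesis using v b(1) by (simp add: cone_def \<rho>_def)
  qed
qed

text \<open>For reflexive and symmetric \<open>E\<close> the graph is the complement of a perfect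
  matching; its clique complex is the join of the matched pairs, the boundary of a
  cross-polytope.\<close>

definition cross_polytope :: "('a \<Rightarrow> 'a \<Rightarrow> bool) \<Rightarrow> 'a set \<Rightarrow> bool" where
  "cross_polytope E V \<longleftrightarrow> (\<forall>v\<in>V. \<exists>!w. w \<in> V \<and> \<not> E v w)"

section \<open>Chains on the cliques of a finite graph\<close>

locale finite_graph =
  fixes U :: "'a::linorder set" and E :: "'a \<Rightarrow> 'a \<Rightarrow> bool"
  assumes finite_vertices: "finite U"
    and adj_refl: "x \<in> U \<Longrightarrow> E x x"
    and adj_sym: "x \<in> U \<Longrightarrow> y \<in> U \<Longrightarrow> E x y \<Longrightarrow> E y x"
begin

abbreviation bd :: "('a set \<Rightarrow> 'f::field) \<Rightarrow> 'a set \<Rightarrow> 'f" where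
  "bd \<equiv> boundary_sum U"

text \<open>The index \<open>m\<close> counts vertices, so the dimension is \<open>m - 1\<close>,
  and \<open>m = 0\<close> leaves the multiples of the empty simplex.\<close>

definition clique_chain :: "'a set \<Rightarrow> nat \<Rightarrow> ('a set \<Rightarrow> 'f::field) \<Rightarrow> bool" where
  "clique_chain V m c \<longleftrightarrow>
     (\<forall>\<sigma>. c \<sigma> \<noteq> 0 \<longrightarrow> \<sigma> \<subseteq> V \<and> card \<sigma> = m \<and> (\<forall>x\<in>\<sigma>. \<forall>y\<in>\<sigma>. E x y))"

definition clique_cycle :: "'a set \<Rightarrow> nat \<Rightarrow> ('a set \<Rightarrow> 'f::field) \<Rightarrow> bool" where
  "clique_cycle V m c \<longleftrightarrow> clique_chain V m c \<and> (\<forall>\<tau>. bd c \<tau> = 0)"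

text \<open>Vanishing of reduced homology in degree \<open>m - 1\<close> of the clique complex on
  \<open>V\<close>. The type argument fixes the coefficient field.\<close>

definition exact_at :: "'f::field itself \<Rightarrow> 'a set \<Rightarrow> nat \<Rightarrow> bool" where
  "exact_at F V m \<longleftrightarrow>
     (\<forall>c :: 'a set \<Rightarrow> 'f. clique_cycle V m c \<longrightarrow>
        (\<exists>b. clique_chain V (Suc m) b \<and> (\<forall>\<tau>. bd b \<tau> = c \<tau>)))"

definition link :: "'a set \<Rightarrow> 'a \<Rightarrow> 'a set" where
  "link V v = {w\<in>V. w \<noteq> v \<and> E v w}"

definition without :: "'a \<Rightarrow> ('a set \<Rightarrow> 'f::field) \<Rightarrow> 'a set \<Rightarrow> 'f" where
  "without v c \<sigma> = (if v \<in> \<sigma> then 0 else c \<sigma>)"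

text \<open>The function supported on sets avoiding \<open>v\<close> whose cone is the part of
  \<open>c\<close> on simplices containing \<open>v\<close>.\<close>

definition link_part :: "'a \<Rightarrow> ('a set \<Rightarrow> 'f::field) \<Rightarrow> 'a set \<Rightarrow> 'f" where
  "link_part v c \<sigma> = (if v \<in> \<sigma> then 0 else face_sign v \<sigma> * c (insert v \<sigma>))"

lemma finite_if_subset: "V \<subseteq> U \<Longrightarrow> finite V"
  using finite_vertices finite_subset by blast

lemma clique_chainD:
  assumes "clique_chain V m c" "c \<sigma> \<noteq> 0"
  shows "\<sigma> \<subseteq> V" "card \<sigma> = m" "x \<in> \<sigma> \<Longrightarrow> y \<in> \<sigma> \<Longrightarrow> E x y"
  using assms by (auto simp: clique_chain_def)

lemma zero_chain: "clique_chain V m (\<lambda>_. 0)" "bd (\<lambda>_. 0) \<tau> = 0"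
  by (simp_all add: clique_chain_def boundary_sum_def)

lemma clique_chain_outside: "clique_chain V m c \<Longrightarrow> \<not> \<sigma> \<subseteq> V \<Longrightarrow> c \<sigma> = 0"
  by (auto simp: clique_chain_def)

lemma clique_chain_mono: "clique_chain V m c \<Longrightarrow> V \<subseteq> W \<Longrightarrow> clique_chain W m c"
  unfolding clique_chain_def by blast

lemma clique_chain_add:
  "clique_chain V m a \<Longrightarrow> clique_chain V m b \<Longrightarrow> clique_chain V m (\<lambda>\<sigma>. a \<sigma> + b \<sigma>)"
  unfolding clique_chain_def by (metis add_0)

lemma clique_chain_diff:
  "clique_chain V m a \<Longrightarrow> clique_chain V m b \<Longrightarrow> clique_chain V m (\<lambda>\<sigma>. a \<sigma> - b \<sigma>)"
  unfolding clique_chain_def by (metis diff_self)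

lemma clique_chain_without: "clique_chain V m c \<Longrightarrow> clique_chain (V - {v}) m (without v c)"
  by (auto simp: clique_chain_def without_def)

lemma decompose: "c \<sigma> = without v c \<sigma> + cone v (link_part v c) \<sigma>"
  by (auto simp: without_def link_part_def cone_def insert_absorb simp flip: mult.assoc)

lemma cone_zero: "(\<And>\<sigma>. b \<sigma> = 0) \<Longrightarrow> cone v b \<tau> = 0"
  by (simp add: cone_def)

lemma clique_chain_link_part:
  assumes "V \<subseteq> U" and c: "clique_chain V (Suc m) c"
  shows "clique_chain (link V v) m (link_part v c)"
  unfolding clique_chain_def
proof (intro allI impI)
  fix \<sigma> assume "link_part v c \<sigma> \<noteq> 0"
  then have *: "v \<notin> \<sigma>" "c (insert v \<sigma>) \<noteq> 0" by (auto simp: link_part_def split: if_splits)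
  then have "finite (insert v \<sigma>)"
    using clique_chainD(1)[OF c *(2)] assms(1) by (intro finite_if_subset) blast
  then show "\<sigma> \<subseteq> link V v \<and> card \<sigma> = m \<and> (\<forall>x\<in>\<sigma>. \<forall>y\<in>\<sigma>. E x y)"
    using clique_chainD[OF c *(2)] * by (auto simp: link_def)
qed

lemma link_subset: "link V v \<subseteq> V" and link_irrefl: "v \<notin> link V v"
  by (auto simp: link_def)

lemma clique_chain_cone:
  assumes "V \<subseteq> U" "v \<in> V" and b: "clique_chain (link V v) m b"
  shows "clique_chain V (Suc m) (cone v b)"
  unfolding clique_chain_def
proof (intro allI impI)
  fix \<sigma> assume "cone v b \<sigma> \<noteq> 0"
  then have *: "v \<in> \<sigma>" "b (\<sigma> - {v}) \<noteq> 0" by (auto simp: cone_def split: if_splits)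
  note b = clique_chainD[OF b *(2)]
  have "\<sigma> - {v} \<subseteq> U" using b(1) link_subset[of V v] assms(1) by (meson subset_trans)
  then have "finite (\<sigma> - {v})" by (rule finite_if_subset)
  then have "finite \<sigma>" by simp
  then have "card \<sigma> = Suc m" unfolding b(2)[symmetric] using *(1) by (rule card.remove)
  moreover have "\<sigma> \<subseteq> V" using b(1) assms(2) by (auto simp: link_def)
  moreover have "E x y" if "x \<in> \<sigma>" "y \<in> \<sigma>" for x y
  proof -
    have "E v w" if "w \<in> \<sigma>" for w
      using that b(1) adj_refl assms(1,2) by (cases "w = v") (auto simp: link_def)
    then show ?thesis
      using that b(3)[of x y] adj_sym[of v] assms(1,2) \<open>\<sigma> \<subseteq> V\<close> by (metis Diff_iff singletonD subsetD)
  qed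
  ultimately show "\<sigma> \<subseteq> V \<and> card \<sigma> = Suc m \<and> (\<forall>x\<in>\<sigma>. \<forall>y\<in>\<sigma>. E x y)" by blast
qed

lemma bd_cone:
  assumes "V \<subseteq> U" "v \<in> U" "v \<notin> V" "clique_chain V m b"
  shows "bd (cone v b) \<tau> = b \<tau> - cone v (bd b) \<tau>"
  using assms finite_vertices
  by (intro boundary_sum_cone) (auto intro!: clique_chain_outside[OF assms(4)])

text \<open>The join formula, applied to \<open>c = without v c + cone v (link_part v c)\<close>,
  turns \<open>bd c = 0\<close> into one equation. On faces avoiding \<open>v\<close> it yields the
  first claim, on faces containing \<open>v\<close> the second.\<close>

lemma cycle_decompose:
  assumes "V \<subseteq> U" "v \<in> V" "clique_cycle V (Suc m) c"
  shows "bd (without v c) \<tau> = - link_part v c \<tau>" "clique_cycle (link V v) m (link_part v c)"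
proof -
  have c: "clique_chain V (Suc m) c" "\<And>\<tau>. bd c \<tau> = 0"
    using assms(3) by (auto simp: clique_cycle_def)
  note l = clique_chain_link_part[OF assms(1) c(1), of v]
  have v: "v \<in> U" "link V v \<subseteq> U" using assms(1,2) link_subset[of V v] by blast+
  have eq: "bd (without v c) \<tau> + (link_part v c \<tau> - cone v (bd (link_part v c)) \<tau>) = 0" for \<tau>
  proof -
    have "bd c \<tau> = bd (\<lambda>\<sigma>. without v c \<sigma> + cone v (link_part v c) \<sigma>) \<tau>"
      by (simp flip: decompose)
    then show ?thesis
      using c(2) bd_cone[OF v(2,1) link_irrefl l] by (simp add: boundary_sum_add)
  qed
  have avoid: "v \<in> \<tau> \<Longrightarrow> bd (without v c) \<tau> = 0" "v \<in> \<tau> \<Longrightarrow> link_part v c \<tau> = 0"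
     "v \<in> \<tau> \<Longrightarrow> bd (link_part v c) \<tau> = 0" for \<tau>
    by (auto simp: without_def link_part_def intro!: boundary_sum_avoid[of v])
  show "bd (without v c) \<tau> = - link_part v c \<tau>"
    using eq[of \<tau>] avoid[of \<tau>] by (cases "v \<in> \<tau>") (auto simp: cone_def eq_neg_iff_add_eq_0)
  have "bd (link_part v c) \<tau> = 0" for \<tau>
  proof (cases "v \<in> \<tau>")
    case False
    then show ?thesis using eq[of "insert v \<tau>"] avoid[of "insert v \<tau>"] by (simp add: cone_def)
  qed (simp add: avoid)
  then show "clique_cycle (link V v) m (link_part v c)" using l by (simp add: clique_cycle_def)
qed

text \<open>Mayer--Vietoris for the star of \<open>v\<close> and the deletion of \<open>v\<close>, whose intersection is the link.\<close>

lemma exact_at_step: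
  assumes "V \<subseteq> U" "v \<in> V" "exact_at TYPE('f::field) (V - {v}) (Suc m)"
    "exact_at TYPE('f) (link V v) m"
  shows "exact_at TYPE('f) V (Suc m)"
  unfolding exact_at_def
proof (intro allI impI)
  fix c :: "'a set \<Rightarrow> 'f" assume cyc: "clique_cycle V (Suc m) c"
  then have c: "clique_chain V (Suc m) c" by (simp add: clique_cycle_def)
  note dec = cycle_decompose[OF assms(1,2) cyc]
  have v: "v \<in> U" "link V v \<subseteq> U" using assms(1,2) link_subset[of V v] by blast+
  obtain b1 where b1: "clique_chain (link V v) (Suc m) b1" "\<And>\<tau>. bd b1 \<tau> = link_part v c \<tau>"
    using assms(4) dec(2) unfolding exact_at_def by blast
  \<comment> \<open>The boundaries of \<open>without v c\<close> and of \<open>b1\<close>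
    cancel.\<close>
  have "clique_cycle (V - {v}) (Suc m) (\<lambda>\<sigma>. without v c \<sigma> + b1 \<sigma>)"
    using clique_chain_add[OF clique_chain_without[OF c, of v]
        clique_chain_mono[OF b1(1), of "V - {v}"]] dec(1) b1(2)
    by (auto simp: clique_cycle_def boundary_sum_add link_def)
  then obtain b0 where b0: "clique_chain (V - {v}) (Suc (Suc m)) b0"
      "\<And>\<tau>. bd b0 \<tau> = without v c \<tau> + b1 \<tau>"
    using assms(3) unfolding exact_at_def by blast
  \<comment> \<open>Subtracting the cone over \<open>b1\<close> removes the extra \<open>b1\<close>
    from the boundary of \<open>b0\<close> and supplies the missing cone part of
    \<open>c\<close>.\<close>
  have "clique_chain V (Suc (Suc m)) (\<lambda>\<sigma>. b0 \<sigma> - cone v b1 \<sigma>)"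
    using clique_chain_diff[OF clique_chain_mono[OF b0(1), of V] clique_chain_cone[OF assms(1,2) b1(1)]]
    by blast
  moreover have "bd (\<lambda>\<sigma>. b0 \<sigma> - cone v b1 \<sigma>) \<tau> = c \<tau>" for \<tau>
  proof -
    have "cone v (bd b1) = cone v (link_part v c)" using b1(2) by (simp add: fun_eq_iff cone_def)
    then show ?thesis
      using decompose[of c \<tau> v] by (simp add: boundary_sum_diff b0(2) bd_cone[OF v(2,1) link_irrefl b1(1)])
  qed
  ultimately show "\<exists>b. clique_chain V (Suc (Suc m)) b \<and> (\<forall>\<tau>. bd b \<tau> = c \<tau>)" by blast
qed

text \<open>Every clique extends by a vertex \<open>v\<close> adjacent to all of \<open>V\<close>,
  and the cone over the part of a cycle that avoids \<open>v\<close> fills the cycle.\<close>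

lemma exact_at_cone:
  assumes "V \<subseteq> U" "v \<in> V" "\<And>w. w \<in> V \<Longrightarrow> E v w"
  shows "exact_at TYPE('f::field) V (Suc m)"
  unfolding exact_at_def
proof (intro allI impI)
  fix c :: "'a set \<Rightarrow> 'f" assume cyc: "clique_cycle V (Suc m) c"
  then have c: "clique_chain V (Suc m) c" by (simp add: clique_cycle_def)
  have link: "link V v = V - {v}" using assms(3) by (auto simp: link_def)
  have v: "v \<in> U" "link V v \<subseteq> U" using assms(1,2) link_subset[of V v] by blast+
  note w = clique_chain_without[OF c, of v, folded link]
  have "cone v (bd (without v c)) \<tau> = - cone v (link_part v c) \<tau>" for \<tau>
    using cycle_decompose(1)[OF assms(1,2) cyc] by (simp add: cone_def)
  then have "bd (cone v (without v c)) \<tau> = c \<tau>" for \<tau>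
    using decompose[of c \<tau> v] by (simp add: bd_cone[OF v(2,1) link_irrefl w])
  then show "\<exists>b. clique_chain V (Suc (Suc m)) b \<and> (\<forall>\<tau>. bd b \<tau> = c \<tau>)"
    using clique_chain_cone[OF assms(1,2) w] by blast
qed

section \<open>Vanishing of homology on few vertices\<close>

lemma card_link:
  assumes "V \<subseteq> U" "v \<in> V" "A \<subseteq> V" "\<And>w. w \<in> A \<Longrightarrow> \<not> E v w"
  shows "card (link V v) + card A < card V"
proof -
  have fin: "finite V" using assms(1) by (rule finite_if_subset)
  then have "finite A" "finite (link V v)"
    using assms(3) link_subset[of V v] finite_subset by blast+
  moreover have "link V v \<inter> A = {}" using assms(4) by (auto simp: link_def)
  \<comment> \<open>The vertex \<open>v\<close> lies neither in its link nor in \<open>A\<close>,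
    whence the strict inequality.\<close>
  moreover have "v \<notin> A" using assms adj_refl by blast
  then have "link V v \<union> A \<subset> V" using assms link_irrefl[of v V] link_subset[of V v] by blast
  ultimately show ?thesis using psubset_card_mono[OF fin] card_Un_disjoint by metis
qed

text \<open>Induction on the number of vertices. If \<open>v\<close> has a non-neighbour, its link
  loses at least two vertices, which matches the drop from \<open>m\<close> to \<open>m - 1\<close>,
  and the deletion of \<open>v\<close> loses one. If no vertex has a non-neighbour, the complex is a
  cone.\<close>

lemma exact_at_small:
  assumes "V \<subseteq> U" "card V < 2 * m"
  shows "exact_at TYPE('f::field) V m"
  using assms
proof (induction "card V" arbitrary: V m rule: less_induct)
  case less
  obtain m' where m: "m = Suc m'" using less.prems(2) by (cases m) auto
  have fin: "finite V" using less.prems(1) by (rule finite_if_subset)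
  consider "V = {}" | v w where "v \<in> V" "w \<in> V" "\<not> E v w" | v where "v \<in> V" "\<And>w. w \<in> V \<Longrightarrow> E v w"
    by blast
  then show ?case
  proof cases
    case 1
    then have "c = (\<lambda>_. 0)" if "clique_chain V m c" for c :: "'a set \<Rightarrow> 'f"
      using that by (auto simp: fun_eq_iff m) (metis clique_chainD(1,2) card.empty nat.distinct(1) subset_empty)
    then show ?thesis
      unfolding exact_at_def clique_cycle_def
      by (metis (no_types, lifting) zero_chain(1,2))
  next
    case (2 v w)
    have *: "card (link V v) + 1 < card V"
      using card_link[OF less.prems(1) 2(1), of "{w}"] 2 by simp
    have "exact_at TYPE('f) (link V v) m'"
      using * less.prems m link_subset[of V v] by (intro less.hyps) auto
    moreover have "exact_at TYPE('f) (V - {v}) m"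
      using less.prems 2(1) card_Diff1_less[OF fin 2(1)] by (intro less.hyps) auto
    ultimately show ?thesis using exact_at_step less.prems(1) 2(1) m by blast
  next
    case (3 v)
    then show ?thesis using exact_at_cone less.prems(1) m by blast
  qed
qed

text \<open>In the boundary case \<open>card V = 2 * m\<close> some vertex has no non-neighbour,
  which gives a cone, or at least two. In the latter case the link loses three vertices, so link and
  deletion both satisfy the strict bound.\<close>

lemma exact_at_unless_cross_polytope:
  assumes "V \<subseteq> U" "card V \<le> 2 * m" "\<not> (card V = 2 * m \<and> cross_polytope E V)"
  shows "exact_at TYPE('f::field) V m"
proof (cases "card V < 2 * m")
  case True
  then show ?thesis using assms exact_at_small by blast
next
  case False
  then have card: "card V = 2 * m" "\<not> cross_polytope E V" using assms by auto
  have fin: "finite V" using assms(1) by (rule finite_if_subset)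
  obtain v where v: "v \<in> V" "\<not> (\<exists>!w. w \<in> V \<and> \<not> E v w)" using card(2) unfolding cross_polytope_def by blast
  then have "card V > 0" using fin card_gt_0_iff by blast
  then obtain m' where m: "m = Suc m'" using card(1) by (cases m) auto
  show ?thesis
  proof (cases "\<exists>w\<in>V. \<not> E v w")
    case False
    then show ?thesis using exact_at_cone assms(1) v(1) m by blast
  next
    case True
    then obtain w w' where w: "w \<in> V" "w' \<in> V" "\<not> E v w" "\<not> E v w'" "w \<noteq> w'" using v(2) by blast
    have "card (link V v) + 2 < card V"
      using card_link[OF assms(1) v(1), of "{w, w'}"] w by auto
    then have "exact_at TYPE('f) (link V v) m'"
      using assms m card link_subset[of V v] by (intro exact_at_small) auto
    moreover have "exact_at TYPE('f) (V - {v}) m"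
      using assms v(1) card_Diff1_less[OF fin v(1)] by (intro exact_at_small) auto
    ultimately show ?thesis using exact_at_step assms(1) v(1) m by blast
  qed
qed

section \<open>Homology of cross-polytopes\<close>

lemma cross_polytope_no_large_clique:
  assumes "V \<subseteq> U" "cross_polytope E V" "card V = 2 * m" "\<sigma> \<subseteq> V" "\<And>x y. x \<in> \<sigma> \<Longrightarrow> y \<in> \<sigma> \<Longrightarrow> E x y"
  shows "card \<sigma> \<le> m"
proof -
  define p where "p v = (THE w. w \<in> V \<and> \<not> E v w)" for v
  have p: "p v \<in> V" "\<not> E v (p v)" and p_unique: "w \<in> V \<Longrightarrow> \<not> E v w \<Longrightarrow> p v = w" if "v \<in> V" for v w
    using theI'[of "\<lambda>w. w \<in> V \<and> \<not> E v w"] assms(2) that by (auto simp: cross_polytope_def p_def)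
  have fin: "finite V" "finite \<sigma>" using assms(1,4) by (auto intro: finite_if_subset)
  have "p (p v) = v" if "v \<in> V" for v
    using p[OF that] p_unique[of "p v" v] that adj_sym assms(1) by blast
  then have "inj_on p \<sigma>" using assms(4) by (metis inj_onI subsetD)
  then have "card (p ` \<sigma>) = card \<sigma>" by (rule card_image)
  \<comment> \<open>No vertex of a clique is matched with a vertex of the same clique, so the clique
    and its image are disjoint sets of equal size.\<close>
  moreover have "p ` \<sigma> \<inter> \<sigma> = {}" using assms(4,5) p by blast
  moreover have "card (p ` \<sigma> \<union> \<sigma>) \<le> card V" using fin p assms(4) by (intro card_mono) auto
  ultimately show ?thesis using fin assms(3) by (simp add: card_Un_disjoint)
qed

lemma cross_polytope_chain_zero:
  assumes "V \<subseteq> U" "cross_polytope E V" "card V = 2 * m" "clique_chain V (Suc m) c"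
  shows "c = (\<lambda>_. 0)"
proof
  fix \<sigma>
  show "c \<sigma> = 0"
    using cross_polytope_no_large_clique[OF assms(1-3), of \<sigma>] clique_chainD[OF assms(4), of \<sigma>] by force
qed

text \<open>A cross-polytope is the suspension, with apexes \<open>v\<close> and \<open>w\<close>, of a smaller one.\<close>

lemma cross_polytope_cycles:
  assumes "V \<subseteq> U" "cross_polytope E V" "card V = 2 * m"
  shows "\<exists>\<sigma>\<^sub>0. \<forall>a :: 'f::field. \<exists>!c. clique_cycle V m c \<and> c \<sigma>\<^sub>0 = a"
  using assms
proof (induction m arbitrary: V)
  case 0
  then have V: "V = {}" using finite_vertices finite_subset by fastforce
  have "\<exists>!c :: 'a set \<Rightarrow> 'f. clique_cycle V 0 c \<and> c {} = a" for a
  proof (rule ex1I[of _ "\<lambda>\<sigma>. if \<sigma> = {} then a else 0"])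
    fix c :: "'a set \<Rightarrow> 'f"
    assume "clique_cycle V 0 c \<and> c {} = a"
    then show "c = (\<lambda>\<sigma>. if \<sigma> = {} then a else 0)"
      by (auto simp: fun_eq_iff V clique_cycle_def clique_chain_def)
  qed (auto simp: V clique_cycle_def clique_chain_def boundary_sum_def)
  then show ?case by blast
next
  case (Suc m)
  have fin: "finite V" using Suc.prems(1) by (rule finite_if_subset)
  obtain v where v: "v \<in> V" using Suc.prems(3) by fastforce
  then obtain w where w: "w \<in> V" "\<not> E v w" "\<And>u. u \<in> V \<Longrightarrow> \<not> E v u \<Longrightarrow> u = w"
    using Suc.prems(2) by (metis cross_polytope_def)
  have vw: "v \<noteq> w" using adj_refl v w Suc.prems(1) by blast
  have wv: "\<not> E w v" using adj_sym[of w v] v w Suc.prems(1) by blast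
  have "\<exists>!u. u \<in> V \<and> \<not> E w u" using Suc.prems(2) w(1) by (simp add: cross_polytope_def)
  then have wu: "u = v" if "u \<in> V" "\<not> E w u" for u
    using that v wv by auto
  define W where "W = V - {v, w}"
  have links: "link V v = W" "link V w = W"
    using w wu wv vw unfolding link_def W_def by blast+
  have W: "W \<subseteq> U" "card W = 2 * m" "v \<notin> W" "w \<notin> W" "W \<subseteq> V"
    using Suc.prems v w(1) vw fin by (auto simp: W_def)
  have "\<exists>!z. z \<in> W \<and> \<not> E u z" if u: "u \<in> W" for u
  proof -
    have uU: "u \<in> V" "u \<in> U" "u \<noteq> v" "u \<noteq> w" using u W by (auto simp: W_def)
    obtain z where z: "z \<in> V" "\<not> E u z" "\<And>y. y \<in> V \<Longrightarrow> \<not> E u y \<Longrightarrow> y = z"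
      using Suc.prems(2) uU by (metis cross_polytope_def)
    have "\<not> E z u" using z uU adj_sym Suc.prems(1) by blast
    then have "z \<in> W" using z(1) w(3) wu uU unfolding W_def by blast
    then show ?thesis using z(2,3) W(5) by blast
  qed
  then have "cross_polytope E W" by (simp add: cross_polytope_def)
  then obtain \<sigma>\<^sub>0 where \<sigma>\<^sub>0: "\<And>a :: 'f. \<exists>!c. clique_cycle W m c \<and> c \<sigma>\<^sub>0 = a"
    using Suc.IH[OF W(1) _ W(2)] by blast
  then obtain c1 where "clique_cycle W m c1" "c1 \<sigma>\<^sub>0 = (1 :: 'f)" by metis
  then have \<sigma>\<^sub>0W: "v \<notin> \<sigma>\<^sub>0" "w \<notin> \<sigma>\<^sub>0"
    using W clique_chain_outside[of W m c1 \<sigma>\<^sub>0] by (auto simp: clique_cycle_def)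
  have vU: "v \<in> U" "w \<in> U" using v w(1) Suc.prems(1) by auto
  have "\<exists>!c :: 'a set \<Rightarrow> 'f. clique_cycle V (Suc m) c \<and> c (insert v \<sigma>\<^sub>0) = a" for a
  proof -
    obtain c1 :: "'a set \<Rightarrow> 'f" where c1: "clique_cycle W m c1" "c1 \<sigma>\<^sub>0 = face_sign v \<sigma>\<^sub>0 * a"
      using \<sigma>\<^sub>0 by metis
    then have c1': "clique_chain W m c1" "\<And>\<tau>. bd c1 \<tau> = 0" by (auto simp: clique_cycle_def)
    \<comment> \<open>The suspension of \<open>c1\<close>: the contributions \<open>c1\<close> to
      the boundaries of the two cones cancel.\<close>
    define c where "c = (\<lambda>\<sigma>. cone v c1 \<sigma> - cone w c1 \<sigma>)"
    have "clique_chain V (Suc m) c"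
      unfolding c_def using c1'(1) Suc.prems(1) v w(1)
      by (intro clique_chain_diff clique_chain_cone) (auto simp: links)
    moreover have "bd c \<tau> = 0" for \<tau>
      using bd_cone[OF W(1) vU(1) W(3) c1'(1), of \<tau>] bd_cone[OF W(1) vU(2) W(4) c1'(1), of \<tau>] c1'(2)
        cone_zero[of "bd c1", OF c1'(2)]
      by (simp add: c_def boundary_sum_diff)
    moreover have "c (insert v \<sigma>\<^sub>0) = a"
      using \<sigma>\<^sub>0W vw c1(2) by (simp add: c_def cone_def flip: mult.assoc)
    moreover have "x = y"
      if x: "clique_cycle V (Suc m) x" "x (insert v \<sigma>\<^sub>0) = a"
        and y: "clique_cycle V (Suc m) y" "y (insert v \<sigma>\<^sub>0) = a" for x y :: "'a set \<Rightarrow> 'f"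
    proof -
      \<comment> \<open>By the induction hypothesis this one coefficient determines the whole link
        part.\<close>
      have "link_part v x \<sigma>\<^sub>0 = link_part v y \<sigma>\<^sub>0" using x y by (simp add: link_part_def)
      then have eq: "link_part v x = link_part v y"
        using \<sigma>\<^sub>0 cycle_decompose(2)[OF Suc.prems(1) v x(1)] cycle_decompose(2)[OF Suc.prems(1) v y(1)]
        by (metis links(1))
      define z where "z = (\<lambda>\<sigma>. without v x \<sigma> - without v y \<sigma>)"
      have "clique_chain (V - {v}) (Suc m) z"
        unfolding z_def using x y by (intro clique_chain_diff clique_chain_without) (auto simp: clique_cycle_def)
      moreover have "bd z \<tau> = 0" for \<tau>
        using cycle_decompose(1)[OF Suc.prems(1) v x(1), of \<tau>] cycle_decompose(1)[OF Suc.prems(1) v y(1), of \<tau>] eq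
        by (simp add: z_def boundary_sum_diff)
      \<comment> \<open>After deletion of \<open>v\<close>, the vertex \<open>w\<close> is adjacent
        to everything, so the cycle \<open>z\<close> bounds.\<close>
      moreover have "exact_at TYPE('f) (V - {v}) (Suc m)"
        using Suc.prems(1) w(1) vw wu by (intro exact_at_cone[of _ w]) auto
      ultimately obtain b where b: "clique_chain (V - {v}) (Suc (Suc m)) b" "\<And>\<tau>. bd b \<tau> = z \<tau>"
        by (auto simp: exact_at_def clique_cycle_def)
      \<comment> \<open>Cliques have at most \<open>Suc m\<close> vertices, so the filling is zero,
        and with it \<open>z\<close>.\<close>
      have "b = (\<lambda>_. 0)"
        using cross_polytope_chain_zero[OF Suc.prems] clique_chain_mono[OF b(1)] by blast
      then have "z \<tau> = 0" for \<tau> using b(2)[of \<tau>] by (simp add: zero_chain)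
      then have "without v x = without v y" by (simp add: z_def fun_eq_iff)
      then show ?thesis using decompose[of x _ v] decompose[of y _ v] eq by (metis ext)
    qed
    ultimately show ?thesis unfolding clique_cycle_def by metis
  qed
  then show ?case by blast
qed

end

section \<open>Persistent homology of few points\<close>

text \<open>The sum over simplices and their faces is reindexed by the removed vertex: only
  \<open>insert v \<tau>\<close> loses \<open>v\<close> to become \<open>\<tau>\<close>, and only if
  \<open>v \<notin> \<tau>\<close>.\<close>

lemma lookup_bdry:
  fixes c :: "'a::linorder set \<Rightarrow>\<^sub>0 'f::field"
  assumes "finite U" "Poly_Mapping.keys c \<subseteq> Pow U"
  shows "Poly_Mapping.lookup (bdry c) \<tau> = boundary_sum U (Poly_Mapping.lookup c) \<tau>"
proof -
  let ?c = "Poly_Mapping.lookup c"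
  define f where "f \<sigma> v = (- 1) ^ card {w\<in>\<sigma>. w < v} * ?c \<sigma>" for \<sigma> v
  have "Poly_Mapping.lookup (bdry c) \<tau>
      = (\<Sum>\<sigma>\<in>Poly_Mapping.keys c. \<Sum>v\<in>\<sigma>. if \<sigma> - {v} = \<tau> then f \<sigma> v else 0)"
    unfolding bdry_def f_def by (simp add: lookup_sum lookup_single when_def)
  also have "\<dots> = (\<Sum>\<sigma>\<in>Pow U. \<Sum>v\<in>\<sigma>. if \<sigma> - {v} = \<tau> then f \<sigma> v else 0)"
    using assms by (intro sum.mono_neutral_left) (auto simp: f_def in_keys_iff intro!: sum.neutral)
  also have "\<dots> = (\<Sum>\<sigma>\<in>Pow U. \<Sum>v\<in>U. if v \<in> \<sigma> \<and> \<sigma> - {v} = \<tau> then f \<sigma> v else 0)"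
    using assms(1) by (intro sum.cong refl sum.mono_neutral_cong_left) auto
  also have "\<dots> = (\<Sum>v\<in>U. \<Sum>\<sigma>\<in>Pow U. if v \<in> \<sigma> \<and> \<sigma> - {v} = \<tau> then f \<sigma> v else 0)"
    by (rule sum.swap)
  also have "\<dots> = (\<Sum>v\<in>U. \<Sum>\<sigma>\<in>Pow U. if \<sigma> = insert v \<tau> then (if v \<in> \<tau> then 0 else f \<sigma> v) else 0)"
    by (intro sum.cong refl) auto
  also have "\<dots> = (\<Sum>v\<in>U. if insert v \<tau> \<in> Pow U then (if v \<in> \<tau> then 0 else f (insert v \<tau>) v) else 0)"
    using assms(1) by (intro sum.cong refl) (simp only: sum.delta finite_Pow_iff)
  also have "\<dots> = boundary_sum U ?c \<tau>"
  proof (cases "\<tau> \<subseteq> U")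
    case True
    have "f (insert v \<tau>) v = face_sign v \<tau> * ?c (insert v \<tau>)" for v
      unfolding f_def face_sign_def by (intro arg_cong2[of _ _ _ _ "(*)"] arg_cong[of _ _ "\<lambda>A. _ ^ card A"]) auto
    then show ?thesis using True assms(1)
      by (simp add: boundary_sum_def sum.If_cases) (intro sum.mono_neutral_cong, auto)
  qed (auto simp: boundary_sum_def)
  finally show ?thesis .
qed

section \<open>Vietoris-Rips complexes as clique complexes\<close>

lemma VR_iff:
  assumes "finite Y"
  shows "\<sigma> \<in> VR d Y r \<longleftrightarrow> \<sigma> \<subseteq> Y \<and> \<sigma> \<noteq> {} \<and> (\<forall>x\<in>\<sigma>. \<forall>y\<in>\<sigma>. d x y \<le> r)"
proof (cases "\<sigma> \<subseteq> Y \<and> \<sigma> \<noteq> {}")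
  case True
  then have fin: "finite \<sigma>" using assms finite_subset by blast
  have "{d x y | x y. x \<in> \<sigma> \<and> y \<in> \<sigma>} = (\<lambda>(x, y). d x y) ` (\<sigma> \<times> \<sigma>)" by auto
  then have "diam d \<sigma> \<le> r \<longleftrightarrow> (\<forall>x\<in>\<sigma>. \<forall>y\<in>\<sigma>. d x y \<le> r)"
    using True fin by (auto simp: diam_def)
  then show ?thesis using True fin by (simp add: VR_def)
qed (auto simp: VR_def)

locale vietoris_rips =
  fixes Y :: "'a::linorder set" and d :: "'a \<Rightarrow> 'a \<Rightarrow> real" and r :: real
  assumes finite_points: "finite Y"
    and dist_self: "x \<in> Y \<Longrightarrow> d x x = 0"
    and dist_sym: "x \<in> Y \<Longrightarrow> y \<in> Y \<Longrightarrow> d x y = d y x"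
    and radius_nonneg: "0 \<le> r"
begin

sublocale finite_graph Y "\<lambda>x y. d x y \<le> r"
  by unfold_locales (use finite_points dist_self dist_sym radius_nonneg in auto)

text \<open>Degree \<open>k\<close> means \<open>Suc k\<close> vertices, which is positive, so the
  absence of the empty set from \<open>VR\<close> makes no difference here.\<close>

lemma chains_iff: "c \<in> chains (VR d Y r) k \<longleftrightarrow> clique_chain Y (Suc k) (Poly_Mapping.lookup c)"
  unfolding chains_def clique_chain_def
  by (auto simp: VR_iff[OF finite_points] subset_iff in_keys_iff)

lemma bdry_chain:
  assumes "c \<in> chains (VR d Y r) k"
  shows "Poly_Mapping.lookup (bdry c) \<tau> = bd (Poly_Mapping.lookup c) \<tau>"
  using assms unfolding chains_def by (intro lookup_bdry finite_points) (auto simp: VR_def)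

lemma cycles_iff: "c \<in> cycles (VR d Y r) k \<longleftrightarrow> clique_cycle Y (Suc k) (Poly_Mapping.lookup c)"
proof -
  have "bdry c = 0 \<longleftrightarrow> (\<forall>\<tau>. Poly_Mapping.lookup (bdry c) \<tau> = 0)"
    by (simp add: poly_mapping_eq_iff fun_eq_iff)
  then show ?thesis
    using bdry_chain[of c k] by (auto simp: cycles_def clique_cycle_def chains_iff)
qed

lemma lookup_onto:
  assumes "clique_chain Y m b"
  shows "\<exists>c. Poly_Mapping.lookup c = b"
proof -
  have "{\<sigma>. b \<sigma> \<noteq> 0} \<subseteq> Pow Y" using assms by (auto simp: clique_chain_def)
  then have "finite {\<sigma>. b \<sigma> \<noteq> 0}" using finite_points finite_subset by blast
  then show ?thesis using lookup_Abs_poly_mapping by blast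
qed

lemma boundaries_iff:
  "x \<in> boundaries (VR d Y r) k \<longleftrightarrow>
     (\<exists>b. clique_chain Y (Suc (Suc k)) b \<and> (\<forall>\<tau>. Poly_Mapping.lookup x \<tau> = bd b \<tau>))"
proof
  assume "x \<in> boundaries (VR d Y r) k"
  then obtain c where "c \<in> chains (VR d Y r) (Suc k)" "x = bdry c" by (auto simp: boundaries_def)
  then show "\<exists>b. clique_chain Y (Suc (Suc k)) b \<and> (\<forall>\<tau>. Poly_Mapping.lookup x \<tau> = bd b \<tau>)"
    using chains_iff bdry_chain by blast
next
  assume "\<exists>b. clique_chain Y (Suc (Suc k)) b \<and> (\<forall>\<tau>. Poly_Mapping.lookup x \<tau> = bd b \<tau>)"
  then obtain b where b: "clique_chain Y (Suc (Suc k)) b" "\<And>\<tau>. Poly_Mapping.lookup x \<tau> = bd b \<tau>"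
    by blast
  obtain c where c: "Poly_Mapping.lookup c = b" using lookup_onto[OF b(1)] by blast
  then have "c \<in> chains (VR d Y r) (Suc k)" using b(1) chains_iff by blast
  moreover from bdry_chain[OF this] have "x = bdry c"
    using b(2) c by (simp add: poly_mapping_eq_iff fun_eq_iff)
  ultimately show "x \<in> boundaries (VR d Y r) k" by (auto simp: boundaries_def)
qed

lemma boundaries_add:
  assumes "x \<in> boundaries (VR d Y r) k" "y \<in> boundaries (VR d Y r) k"
  shows "x + y \<in> boundaries (VR d Y r) k"
proof -
  obtain a b where "clique_chain Y (Suc (Suc k)) a" "clique_chain Y (Suc (Suc k)) b"
    "\<And>\<tau>. Poly_Mapping.lookup x \<tau> = bd a \<tau>" "\<And>\<tau>. Poly_Mapping.lookup y \<tau> = bd b \<tau>"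
    using assms by (auto simp: boundaries_iff)
  then show ?thesis
    using clique_chain_add[of Y _ a b] by (auto simp: boundaries_iff lookup_add simp flip: boundary_sum_add)
qed

lemma boundaries_diff:
  assumes "x \<in> boundaries (VR d Y r) k" "y \<in> boundaries (VR d Y r) k"
  shows "x - y \<in> boundaries (VR d Y r) k"
proof -
  obtain a b where "clique_chain Y (Suc (Suc k)) a" "clique_chain Y (Suc (Suc k)) b"
    "\<And>\<tau>. Poly_Mapping.lookup x \<tau> = bd a \<tau>" "\<And>\<tau>. Poly_Mapping.lookup y \<tau> = bd b \<tau>"
    using assms by (auto simp: boundaries_iff)
  then show ?thesis
    using clique_chain_diff[of Y _ a b] by (auto simp: boundaries_iff lookup_minus simp flip: boundary_sum_diff)
qed

lemma zero_in_cycles: "0 \<in> cycles (VR d Y r) k" and zero_in_boundaries: "0 \<in> boundaries (VR d Y r) k"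
  using zero_chain by (auto simp: cycles_iff boundaries_iff clique_cycle_def fun_eq_iff
      lookup_zero[abs_def] intro!: exI[of _ "\<lambda>_. 0"])

text \<open>Every cycle is a boundary, so all cosets coincide with the space of boundaries.\<close>

lemma homology_exact:
  assumes "exact_at TYPE('f::field) Y (Suc k)"
  shows "vcarrier (reduced_homology (VR d Y r) k) = {boundaries (VR d Y r) k :: ('a set \<Rightarrow>\<^sub>0 'f) set}"
proof -
  let ?B = "boundaries (VR d Y r) k :: ('a set \<Rightarrow>\<^sub>0 'f) set"
  have *: "{z + b | b. b \<in> ?B} = ?B" if "z \<in> cycles (VR d Y r) k" for z
  proof -
    have z: "z \<in> ?B"
      using assms that unfolding exact_at_def cycles_iff boundaries_iff by metis
    have "x = z + (x - z)" for x by simp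
    then show ?thesis using boundaries_add[OF z] boundaries_diff[OF _ z] by blast
  qed
  have "vcarrier (reduced_homology (VR d Y r) k)
      = (\<lambda>z. {z + b | b. b \<in> ?B}) ` cycles (VR d Y r) k"
    by (auto simp: reduced_homology_def)
  also have "\<dots> = (\<lambda>_. ?B) ` (cycles (VR d Y r) k :: ('a set \<Rightarrow>\<^sub>0 'f) set)" by (rule image_cong[OF refl *])
  also have "\<dots> = {?B}" using zero_in_cycles by blast
  finally show ?thesis .
qed

lemma homology_trivial:
  assumes "card Y \<le> 2 * Suc k" "\<not> (card Y = 2 * Suc k \<and> cross_polytope (\<lambda>x y. d x y \<le> r) Y)"
  shows "vcarrier (reduced_homology (VR d Y r) k) = {boundaries (VR d Y r) k :: ('a set \<Rightarrow>\<^sub>0 'f::field) set}"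
  using homology_exact exact_at_unless_cross_polytope[OF subset_refl assms] by blast

text \<open>A cross-polytope on \<open>2 * Suc k\<close> vertices has no clique with
  \<open>k + 2\<close> vertices, so zero is the only chain to take the boundary of.\<close>

lemma boundaries_cross_polytope:
  assumes "card Y = 2 * Suc k" "cross_polytope (\<lambda>x y. d x y \<le> r) Y"
  shows "boundaries (VR d Y r) k = {0 :: 'a set \<Rightarrow>\<^sub>0 'f::field}"
proof -
  have *: "b = (\<lambda>_. 0)" if "clique_chain Y (Suc (Suc k)) b" for b :: "'a set \<Rightarrow> 'f"
    using cross_polytope_chain_zero[OF subset_refl assms(2,1) that] .
  have "x = 0" if "x \<in> boundaries (VR d Y r) k" for x :: "'a set \<Rightarrow>\<^sub>0 'f"
  proof -
    have "Poly_Mapping.lookup x \<tau> = 0" for \<tau>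
      using that * unfolding boundaries_iff by (metis zero_chain(2))
    then show ?thesis by (simp add: poly_mapping_eq_iff fun_eq_iff)
  qed
  then show ?thesis using zero_in_boundaries by blast
qed

lemma homology_cross_polytope:
  assumes "card Y = 2 * Suc k" "cross_polytope (\<lambda>x y. d x y \<le> r) Y"
  shows "vcarrier (reduced_homology (VR d Y r) k)
    = (\<lambda>z. {z}) ` (cycles (VR d Y r) k :: ('a set \<Rightarrow>\<^sub>0 'f::field) set)"
  using boundaries_cross_polytope[OF assms, where 'f = 'f] by (auto simp: reduced_homology_def)

text \<open>The coefficient at a suitable simplex is a coordinate on the cycles; as there are no
  nonzero boundaries, homology is a line.\<close>

lemma cycles_cross_polytope:
  assumes "card Y = 2 * Suc k" "cross_polytope (\<lambda>x y. d x y \<le> r) Y"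
  shows "\<exists>\<sigma>\<^sub>0. bij_betw (\<lambda>z. Poly_Mapping.lookup z \<sigma>\<^sub>0)
    (cycles (VR d Y r) k :: ('a set \<Rightarrow>\<^sub>0 'f::field) set) UNIV"
proof -
  obtain \<sigma>\<^sub>0 where \<sigma>\<^sub>0: "\<And>a :: 'f. \<exists>!c. clique_cycle Y (Suc k) c \<and> c \<sigma>\<^sub>0 = a"
    using cross_polytope_cycles[OF subset_refl assms(2,1)] by blast
  have "inj_on (\<lambda>z. Poly_Mapping.lookup z \<sigma>\<^sub>0) (cycles (VR d Y r) k :: ('a set \<Rightarrow>\<^sub>0 'f) set)"
    using \<sigma>\<^sub>0 by (intro inj_onI) (metis cycles_iff poly_mapping_eq_iff)
  moreover have "\<exists>z\<in>cycles (VR d Y r) k. Poly_Mapping.lookup z \<sigma>\<^sub>0 = a" for a :: 'f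
  proof -
    obtain c where c: "clique_cycle Y (Suc k) c" "c \<sigma>\<^sub>0 = a" using \<sigma>\<^sub>0 by blast
    then obtain z where "Poly_Mapping.lookup z = c" using lookup_onto unfolding clique_cycle_def by blast
    then show ?thesis using c cycles_iff by blast
  qed
  ultimately show ?thesis unfolding bij_betw_def by (intro exI[of _ \<sigma>\<^sub>0]) (simp add: set_eq_iff image_iff eq_commute)
qed

end

section \<open>Diagrams with a single point\<close>

lemma interval_sum_space:
  "vcarrier (pspace (direct_sum [interval_module b d]) r)
     = {..<Suc 0} \<rightarrow>\<^sub>E (if r \<in> {b..<d} then UNIV else {0 :: 'f::field})"
proof -
  have "vcarrier (pspace (direct_sum [interval_module b d]) r)
      = (\<Pi>\<^sub>E i\<in>{..<Suc 0}. vcarrier (pspace ([interval_module b d] ! i) r) :: 'f set)"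
    by (simp add: direct_sum_def)
  also have "\<dots> = {..<Suc 0} \<rightarrow>\<^sub>E (if r \<in> {b..<d} then UNIV else {0})"
    by (intro PiE_cong) (simp add: interval_module_def)
  finally show ?thesis .
qed

lemma has_dgm_single_iff:
  "has_dgm V {#(b, d)#} \<longleftrightarrow> 0 \<le> b \<and> b < d \<and> pers_isomorphic V (direct_sum [interval_module b d])"
  by (auto simp: has_dgm_def)

text \<open>Homology is a line at the radii where the points form a cross-polytope and zero at all
  others, so an isomorphism with the interval module identifies these radii. Conversely the complex
  is constant on the interval, and one coordinate serves at all its radii.\<close>

lemma has_dgm_VR_iff:
  fixes Y :: "'a::linorder set"
  assumes "finite Y" "card Y \<le> 2 * Suc k"
    and "\<And>x. x \<in> Y \<Longrightarrow> d x x = 0" "\<And>x y. x \<in> Y \<Longrightarrow> y \<in> Y \<Longrightarrow> d x y = d y x"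
  shows "has_dgm (VR_module k d Y :: ('f::field, ('a set \<Rightarrow>\<^sub>0 'f) set) pers_module) {#(tb, td)#} \<longleftrightarrow>
    0 \<le> tb \<and> tb < td \<and>
    (\<forall>r\<ge>0. card Y = 2 * Suc k \<and> cross_polytope (\<lambda>x y. d x y \<le> r) Y \<longleftrightarrow> tb \<le> r \<and> r < td)"
    (is "has_dgm ?V _ \<longleftrightarrow> _ \<and> _ \<and> (\<forall>r\<ge>0. ?cross r \<longleftrightarrow> _)")
proof -
  let ?W = "direct_sum [interval_module tb td] :: ('f, nat \<Rightarrow> 'f) pers_module"
  let ?K = "\<lambda>r. VR d Y r"
  have vr: "vietoris_rips Y d r" if "0 \<le> r" for r
    using assms that by unfold_locales auto
  have space: "pspace ?V r = reduced_homology (?K r) k" for r by (simp add: VR_module_def)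
  have trivial: "vcarrier (pspace ?V r) = {boundaries (?K r) k}" if "0 \<le> r" "\<not> ?cross r" for r
    unfolding space using vietoris_rips.homology_trivial[OF vr[OF that(1)] assms(2)] that(2) by blast
  have cross: "vcarrier (pspace ?V r) = (\<lambda>z. {z}) ` cycles (?K r) k"
      "boundaries (?K r) k = {0 :: 'a set \<Rightarrow>\<^sub>0 'f}"
      "\<exists>\<sigma>\<^sub>0. bij_betw (\<lambda>z. Poly_Mapping.lookup z \<sigma>\<^sub>0) (cycles (?K r) k :: ('a set \<Rightarrow>\<^sub>0 'f) set) UNIV"
    if "0 \<le> r" "?cross r" for r
    unfolding space using vietoris_rips.homology_cross_polytope[OF vr[OF that(1)]]
      vietoris_rips.boundaries_cross_polytope[OF vr[OF that(1)]]
      vietoris_rips.cycles_cross_polytope[OF vr[OF that(1)]] that(2) by blast+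
  have W: "vcarrier (pspace ?W r) = {..<Suc 0} \<rightarrow>\<^sub>E (if r \<in> {tb..<td} then UNIV else {0})" for r
    by (rule interval_sum_space)
  \<comment> \<open>Bijectivity suffices: the carrier has more than one element on both sides or on
    neither.\<close>
  have "?cross r \<longleftrightarrow> tb \<le> r \<and> r < td" if iso: "pers_isomorphic ?V ?W" and r: "0 \<le> r" for r
  proof -
    obtain \<phi> where bij: "bij_betw \<phi> (vcarrier (pspace ?V r)) (vcarrier (pspace ?W r))"
      using iso r by (auto simp: pers_isomorphic_def linear_iso_def)
    show ?thesis
    proof (cases "?cross r")
      case True
      then obtain \<sigma>\<^sub>0 where "bij_betw (\<lambda>z. Poly_Mapping.lookup z \<sigma>\<^sub>0) (cycles (?K r) k :: ('a set \<Rightarrow>\<^sub>0 'f) set) UNIV"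
        using cross(3) r by blast
      then have surj: "a \<in> (\<lambda>z. Poly_Mapping.lookup z \<sigma>\<^sub>0) ` (cycles (?K r) k :: ('a set \<Rightarrow>\<^sub>0 'f) set)" for a
        by (simp add: bij_betw_def)
      have "\<exists>z\<in>(cycles (?K r) k :: ('a set \<Rightarrow>\<^sub>0 'f) set). Poly_Mapping.lookup z \<sigma>\<^sub>0 = a" for a
        using surj[of a] by force
      from this[of 0] this[of 1] obtain z w :: "'a set \<Rightarrow>\<^sub>0 'f"
        where "z \<in> cycles (?K r) k" "w \<in> cycles (?K r) k"
          "Poly_Mapping.lookup z \<sigma>\<^sub>0 = 0" "Poly_Mapping.lookup w \<sigma>\<^sub>0 = 1" by blast
      then have "{z} \<in> vcarrier (pspace ?V r)" "{w} \<in> vcarrier (pspace ?V r)" "{z} \<noteq> {w}"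
        using cross(1)[OF r True] by auto
      then have "\<phi> {z} \<in> vcarrier (pspace ?W r)" "\<phi> {w} \<in> vcarrier (pspace ?W r)" "\<phi> {z} \<noteq> \<phi> {w}"
        using bij unfolding bij_betw_def inj_on_def by blast+
      then have "\<not> (\<exists>y. vcarrier (pspace ?W r) = {y})" by auto
      then show ?thesis using True by (auto simp: W PiE_singleton split: if_splits)
    next
      case False
      then have "vcarrier (pspace ?W r) = {\<phi> (boundaries (?K r) k)}"
        using bij trivial[OF r] by (simp add: bij_betw_def)
      moreover have "(\<lambda>i\<in>{..<Suc 0}. 0) \<noteq> (\<lambda>i\<in>{..<Suc 0}. 1 :: 'f)"
        by (metis lessThan_iff lessI restrict_apply' zero_neq_one)
      moreover have "(\<lambda>i\<in>{..<Suc 0}. x) \<in> vcarrier (pspace ?W r)" if "tb \<le> r \<and> r < td" for x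
        using that by (simp add: W)
      ultimately show ?thesis using False by (metis singletonD)
    qed
  qed
  moreover have "pers_isomorphic ?V ?W"
    if tb: "0 \<le> tb" "tb < td" and cr: "\<And>r. 0 \<le> r \<Longrightarrow> ?cross r \<longleftrightarrow> tb \<le> r \<and> r < td"
  proof -
    \<comment> \<open>The only non-neighbour of a vertex at \<open>r\<close> is also a non-neighbour
      at the smaller radius \<open>tb\<close>, hence the only one there.\<close>
    have const: "?K r = ?K tb" if r: "tb \<le> r" "r < td" for r
    proof -
      have c: "?cross tb" "?cross r" using cr[of tb] cr[of r] tb r by auto
      have "d x y \<le> r \<longleftrightarrow> d x y \<le> tb" if "x \<in> Y" "y \<in> Y" for x y
      proof
        assume y: "d x y \<le> r"
        obtain w where w: "w \<in> Y" "\<not> d x w \<le> r" using c(2) \<open>x \<in> Y\<close> by (auto simp: cross_polytope_def)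
        moreover have "\<exists>!w. w \<in> Y \<and> \<not> d x w \<le> tb" using c(1) \<open>x \<in> Y\<close> by (auto simp: cross_polytope_def)
        ultimately show "d x y \<le> tb" using r(1) y \<open>y \<in> Y\<close> by (metis order_trans)
      qed (use r in auto)
      then show ?thesis by (auto simp: VR_iff[OF assms(1)] subset_iff)
    qed
    obtain \<sigma>\<^sub>0 where bij: "bij_betw (\<lambda>z. Poly_Mapping.lookup z \<sigma>\<^sub>0) (cycles (?K tb) k :: ('a set \<Rightarrow>\<^sub>0 'f) set) UNIV"
      using cross(3)[of tb] cr[of tb] tb by auto
    \<comment> \<open>Inside the interval classes are singletons, hence \<open>the_elem\<close>;
      outside it both spaces are zero.\<close>
    define \<phi> where "\<phi> r X = (\<lambda>i\<in>{..<Suc 0}. if r \<in> {tb..<td} then Poly_Mapping.lookup (the_elem X) \<sigma>\<^sub>0 else 0)"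
      for r :: real and X :: "('a set \<Rightarrow>\<^sub>0 'f) set"
    have carrier: "vcarrier (pspace ?V r) = (\<lambda>z. {z}) ` cycles (?K tb) k"
        "boundaries (?K r) k = {0 :: 'a set \<Rightarrow>\<^sub>0 'f}" if "tb \<le> r" "r < td" for r
      using cross(1,2)[of r] cr[of r] const[OF that] tb that by auto
    have "linear_iso (pspace ?V r) (pspace ?W r) (\<phi> r)" if r: "0 \<le> r" for r
    proof (cases "tb \<le> r \<and> r < td")
      case False
      then have triv: "vcarrier (pspace ?V r) = {boundaries (?K r) k}" using trivial[OF r] cr[OF r] by blast
      have "vcarrier (pspace ?W r) = {\<phi> r (boundaries (?K r) k)}"
        using False by (auto simp: W \<phi>_def PiE_singleton)
      then show ?thesis
        using False unfolding linear_iso_def triv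
        by (auto simp: bij_betw_def \<phi>_def direct_sum_def interval_module_def fun_eq_iff)
    next
      case True
      note C = carrier[of r]
      have "bij_betw (\<phi> r) (vcarrier (pspace ?V r)) (vcarrier (pspace ?W r))"
      proof (rule bij_betw_byWitness[where f' = "\<lambda>f. {the_inv_into (cycles (?K tb) k) (\<lambda>z. Poly_Mapping.lookup z \<sigma>\<^sub>0) (f 0)}"])
        show "\<forall>a\<in>vcarrier (pspace ?V r). {the_inv_into (cycles (?K tb) k) (\<lambda>z. Poly_Mapping.lookup z \<sigma>\<^sub>0) (\<phi> r a 0)} = a"
          using True C the_inv_into_f_f[OF bij_betw_imp_inj_on[OF bij]] by (auto simp: \<phi>_def)
        show "\<forall>f\<in>vcarrier (pspace ?W r). \<phi> r {the_inv_into (cycles (?K tb) k) (\<lambda>z. Poly_Mapping.lookup z \<sigma>\<^sub>0) (f 0)} = f"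
        proof
          fix f assume f: "f \<in> vcarrier (pspace ?W r)"
          have "Poly_Mapping.lookup (the_inv_into (cycles (?K tb) k) (\<lambda>z. Poly_Mapping.lookup z \<sigma>\<^sub>0) (f 0)) \<sigma>\<^sub>0 = f 0"
            using f_the_inv_into_f_bij_betw[OF bij] by simp
          then show "\<phi> r {the_inv_into (cycles (?K tb) k) (\<lambda>z. Poly_Mapping.lookup z \<sigma>\<^sub>0) (f 0)} = f"
            using f True by (auto simp: \<phi>_def W PiE_iff extensional_def fun_eq_iff)
        qed
        show "\<phi> r ` vcarrier (pspace ?V r) \<subseteq> vcarrier (pspace ?W r)"
          using True by (auto simp: \<phi>_def W split: if_splits)
        show "(\<lambda>f. {the_inv_into (cycles (?K tb) k) (\<lambda>z. Poly_Mapping.lookup z \<sigma>\<^sub>0) (f 0)}) ` vcarrier (pspace ?W r)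
            \<subseteq> vcarrier (pspace ?V r)"
          using True C bij_betw_the_inv_into[OF bij] by (auto simp: bij_betw_def)
      qed
      moreover have "\<phi> r (vadd (pspace ?V r) X X') = vadd (pspace ?W r) (\<phi> r X) (\<phi> r X')"
        if X: "X \<in> vcarrier (pspace ?V r)" "X' \<in> vcarrier (pspace ?V r)" for X X'
      proof -
        obtain x x' where "X = {x}" "X' = {x'}" using X C True by auto
        then show ?thesis using True
          by (auto simp: \<phi>_def VR_module_def reduced_homology_def direct_sum_def interval_module_def lookup_add fun_eq_iff)
      qed
      moreover have "\<phi> r (vscale (pspace ?V r) a X) = vscale (pspace ?W r) a (\<phi> r X)"
        if X: "X \<in> vcarrier (pspace ?V r)" for X a
      proof -
        obtain x where "X = {x}" using X C True by auto
        then show ?thesis using True C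
          by (auto simp: \<phi>_def VR_module_def reduced_homology_def direct_sum_def interval_module_def
              Poly_Mapping.map.rep_eq when_def fun_eq_iff)
      qed
      ultimately show ?thesis unfolding linear_iso_def by blast
    qed
    moreover have "\<phi> s (pmap ?V r s X) = pmap ?W r s (\<phi> r X)"
      if rs: "0 \<le> r" "r \<le> s" and X: "X \<in> vcarrier (pspace ?V r)" for r s X
    proof -
      consider "\<not> (tb \<le> s \<and> s < td)" | "tb \<le> r" "s < td" | "r < tb" "tb \<le> s" "s < td"
        using rs by linarith
      then show ?thesis
      proof cases
        case 1
        then show ?thesis by (auto simp: \<phi>_def direct_sum_def interval_module_def fun_eq_iff)
      next
        case 2
        then obtain x where x: "X = {x}" using X carrier[of r] rs by auto
        then have "pmap ?V r s X = X" using 2 carrier[of s] rs by (auto simp: VR_module_def)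
        then show ?thesis using 2 rs by (auto simp: \<phi>_def direct_sum_def interval_module_def fun_eq_iff)
      next
        case 3
        \<comment> \<open>Before \<open>tb\<close> the only class is the space of boundaries, which
          lies in the zero space of boundaries at \<open>s\<close>.\<close>
        have "chains (?K r) (Suc k) \<subseteq> (chains (?K s) (Suc k) :: ('a set \<Rightarrow>\<^sub>0 'f) set)"
          using rs by (auto simp: chains_def VR_def)
        then have "boundaries (?K r) k \<subseteq> (boundaries (?K s) k :: ('a set \<Rightarrow>\<^sub>0 'f) set)"
          by (auto simp: boundaries_def)
        moreover have s: "boundaries (?K s) k = {0 :: 'a set \<Rightarrow>\<^sub>0 'f}" using carrier 3 by blast
        moreover have "0 \<in> (boundaries (?K r) k :: ('a set \<Rightarrow>\<^sub>0 'f) set)"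
          using vietoris_rips.zero_in_boundaries[OF vr] rs by blast
        ultimately have "boundaries (?K r) k = {0 :: 'a set \<Rightarrow>\<^sub>0 'f}" by blast
        then have "X = {0}" using X trivial[of r] cr[of r] 3 rs by auto
        then have "pmap ?V r s X = {0}" using s by (auto simp: VR_module_def)
        then show ?thesis using 3 by (auto simp: \<phi>_def direct_sum_def interval_module_def fun_eq_iff)
      qed
    qed
    ultimately show ?thesis unfolding pers_isomorphic_def by blast
  qed
  ultimately show ?thesis unfolding has_dgm_single_iff by blast
qed

section \<open>Cyclically ordered points on the circle\<close>

lemma circle_dist_commute: "circle_dist x y = circle_dist y x"
  by (simp add: circle_dist_def abs_minus_commute)

text \<open>Representatives differ by less than a full turn, which leaves only \<open>m = 0\<close>
  and \<open>m = 1\<close>.\<close>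

lemma circle_dist_lift:
  fixes m :: int
  assumes "u \<in> circle" "v \<in> circle" "t = v - u + 2 * pi * m" "0 \<le> t" "t \<le> 2 * pi"
  shows "circle_dist u v = min t (2 * pi - t)"
proof -
  have "2 * pi * (- 1) < 2 * pi * m" "2 * pi * m < 2 * pi * 2"
    using assms unfolding circle_def atLeastLessThan_iff by linarith+
  then have "- 1 < real_of_int m" "real_of_int m < 2"
    by (simp_all only: mult_less_cancel_left_pos pi_gt_zero zero_less_numeral mult_pos_pos)
  then have "m = 0 \<or> m = 1" by linarith
  then show ?thesis using assms by (auto simp: circle_dist_def circle_def min_def)
qed

text \<open>\<open>X\<close> lifts to the real line the cyclic enumeration, in counterclockwise order, of \<open>n\<close> points
  of the circle.\<close>

locale circle_points =
  fixes n :: nat and X :: "nat \<Rightarrow> real"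
  assumes n_pos: "0 < n"
    and step: "X i < X (Suc i)"
    and period: "X (i + n) = X i + 2 * pi"
    and in_circle: "i < n \<Longrightarrow> X i \<in> circle"
begin

definition point :: "nat \<Rightarrow> real" where
  "point i = X (i mod n)"

definition points :: "real set" where
  "points = X ` {..<n}"

text \<open>Meant for \<open>i \<le> j \<le> i + n\<close>: the shorter of the two arcs, measured on
  the lift so that passing the base point needs no case distinction.\<close>

definition arc_dist :: "nat \<Rightarrow> nat \<Rightarrow> real" where
  "arc_dist i j = min (X j - X i) (2 * pi - (X j - X i))"

lemma X_strict_mono: "i < j \<Longrightarrow> X i < X j"
  using lift_Suc_mono_less[of X] step by blast

lemma X_mono: "i \<le> j \<Longrightarrow> X i \<le> X j"
  using X_strict_mono by (metis le_less)

lemma X_inj: "X i = X j \<longleftrightarrow> i = j"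
  using X_strict_mono by (metis less_irrefl linorder_neqE_nat)

lemma period_mult: "X (i + m * n) = X i + 2 * pi * m"
proof (induction m)
  case (Suc m)
  have "X (i + Suc m * n) = X ((i + m * n) + n)" by (simp add: algebra_simps)
  then show ?case using Suc period[of "i + m * n"] by (simp add: algebra_simps)
qed simp

lemma X_eq_point: "X i = point i + 2 * pi * (i div n)"
  using period_mult[of "i mod n" "i div n"] by (simp add: point_def)

lemma point_in_circle: "point i \<in> circle"
  using in_circle n_pos by (simp add: point_def)

lemma point_in_points: "point i \<in> points"
  using n_pos by (auto simp: point_def points_def)

lemma points_subset: "points \<subseteq> circle"
  using in_circle by (auto simp: points_def)

lemma finite_points: "finite points"
  by (simp add: points_def)

lemma card_points: "card points = n"
  by (simp add: points_def card_image inj_on_def X_inj)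

lemma circle_dist_point:
  assumes "i \<le> j" "j \<le> i + n"
  shows "circle_dist (point i) (point j) = arc_dist i j"
  unfolding arc_dist_def
proof (rule circle_dist_lift[where m = "int (j div n) - int (i div n)"])
  show "X j - X i = point j - point i + 2 * pi * real_of_int (int (j div n) - int (i div n))"
    using X_eq_point[of i] X_eq_point[of j] by (simp add: algebra_simps)
  show "0 \<le> X j - X i" "X j - X i \<le> 2 * pi"
    using X_mono[OF assms(1)] X_mono[OF assms(2)] period[of i] by auto
qed (rule point_in_circle)+

lemma point_shift: "point (i + n) = point i"
  by (simp add: point_def)

lemma point_inj_window:
  assumes "point a = point b" "i \<le> a" "a < i + n" "i \<le> b" "b < i + n"
  shows "a = b"
proof -
  have aux: "a = b" if "a mod n = b mod n" "a \<le> b" "b < a + n" for a b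
  proof -
    have "n dvd b - a" using mod_eq_dvd_iff_nat[OF that(2), of n] that(1) by simp
    moreover have "b - a < n" using that by linarith
    ultimately have "b - a = 0" using nat_dvd_not_less by blast
    then show ?thesis using that(2) by simp
  qed
  have "a mod n = b mod n" using assms(1) by (simp add: point_def X_inj)
  then show ?thesis using aux[of a b] aux[of b a] assms(2-5) by (cases "a \<le> b") auto
qed

text \<open>Allows an argument to start the cyclic enumeration at any chosen point.\<close>

lemma points_window: "points = point ` {i..<i + n}"
proof -
  have "inj_on point {i..<i + n}" using point_inj_window by (intro inj_onI) auto
  then have "card (point ` {i..<i + n}) = card points" by (simp add: card_image card_points)
  then show ?thesis
    using card_subset_eq[OF finite_points] point_in_points by (metis image_subsetI)
qed

lemma arc_dist_le_pi: "arc_dist i j \<le> pi"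
  by (auto simp: arc_dist_def min_def)

end

section \<open>Cross-polytopes formed by points of the circle\<close>

locale circle_points_even = circle_points "2 * Suc k" X for k X
begin

abbreviation far :: "real \<Rightarrow> nat \<Rightarrow> nat \<Rightarrow> bool" where
  "far r i j \<equiv> \<not> circle_dist (point i) (point j) \<le> r"

lemma far_unique:
  assumes "cross_polytope (\<lambda>x y. circle_dist x y \<le> r) points" "far r i a" "far r i b"
    "l \<le> a" "a < l + 2 * Suc k" "l \<le> b" "b < l + 2 * Suc k"
  shows "a = b"
proof -
  have "\<exists>!y. y \<in> points \<and> \<not> circle_dist (point i) y \<le> r"
    using assms(1) point_in_points[of i] unfolding cross_polytope_def by blast
  then have "point a = point b" using assms(2,3) point_in_points by blast
  then show ?thesis using assms(4-7) by (rule point_inj_window)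
qed

text \<open>Chords joining points at distance more than \<open>r\<close> cross each other, so matching each point on one
  side of such a chord with the other endpoint of its chord injects that side into the other one.\<close>

lemma far_sides:
  assumes cross: "cross_polytope (\<lambda>x y. circle_dist x y \<le> r) points" and "0 \<le> r"
    and ij: "i < j" "j < i + 2 * Suc k" "far r i j"
  shows "j - i \<le> i + 2 * Suc k - j"
proof -
  let ?n = "2 * Suc k"
  have far_sym: "far r a b \<Longrightarrow> far r b a" for a b by (simp add: circle_dist_commute)
  have far: "far r a b \<longleftrightarrow> r < arc_dist a b" if "a \<le> b" "b \<le> a + ?n" for a b
    using circle_dist_point[OF that] by auto
  \<comment> \<open>The arc from \<open>i\<close> to \<open>b\<close> contains the one from
    \<open>a\<close> to \<open>b\<close>, and its complement contains that of the arc from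
    \<open>i\<close> to \<open>j\<close>. So \<open>i\<close> would be far from both
    \<open>b\<close> and \<open>j\<close>.\<close>
  have nested: False if abc: "i < a" "a < b" "b < j" "far r a b" for a b
  proof -
    have "r < arc_dist a b" "r < arc_dist i j" using far abc ij by auto
    moreover have "X i < X a" "X b < X j" using X_strict_mono abc by auto
    ultimately have "r < arc_dist i b" by (auto simp: arc_dist_def)
    then have "far r i b" using far abc ij by auto
    then have "b = j" using far_unique[OF cross _ ij(3), of b i] abc ij by auto
    then show False using abc by simp
  qed
  have "\<exists>w\<in>{j<..<i + ?n}. far r z w" if z: "z \<in> {i<..<j}" for z
  proof -
    obtain y where "y \<in> points" "\<not> circle_dist (point z) y \<le> r"
      using cross point_in_points[of z] unfolding cross_polytope_def by blast
    then obtain l where l: "l \<in> {i..<i + ?n}" "far r z l" using points_window[of i] by auto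
    have "l \<noteq> z" using l(2) far[of z z] \<open>0 \<le> r\<close> by (auto simp: arc_dist_def)
    moreover have "l \<noteq> i" using far_unique[OF cross _ ij(3), of z i] far_sym[OF l(2)] z ij by auto
    moreover have "l \<noteq> j"
      using far_unique[OF cross _ far_sym[OF ij(3)], of z i] far_sym[OF l(2)] z ij by auto
    moreover have "\<not> (i < l \<and> l < z)" using nested[of l z] far_sym[OF l(2)] z by auto
    moreover have "\<not> (z < l \<and> l < j)" using nested[of z l] l(2) z by auto
    ultimately have "l \<in> {j<..<i + ?n}" using l(1) by auto
    then show ?thesis using l(2) by blast
  qed
  then obtain f where f: "\<And>z. z \<in> {i<..<j} \<Longrightarrow> f z \<in> {j<..<i + ?n} \<and> far r z (f z)" by metis
  have "inj_on f {i<..<j}"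
  proof (rule inj_onI)
    fix z z' assume z: "z \<in> {i<..<j}" "z' \<in> {i<..<j}" "f z = f z'"
    then have "far r (f z) z" "far r (f z) z'" using f far_sym by metis+
    then show "z = z'" using far_unique[OF cross, of "f z" z z' i] z ij by auto
  qed
  then have "card {i<..<j} \<le> card {j<..<i + ?n}" using f by (intro card_inj_on_le[of f]) auto
  then show ?thesis using ij by auto
qed

text \<open>Applying \<open>far_sides\<close> to a chord from each of its endpoints shows that
  equally many points lie on both sides.\<close>

lemma cross_polytope_points_iff:
  assumes "0 \<le> r"
  shows "cross_polytope (\<lambda>x y. circle_dist x y \<le> r) points \<longleftrightarrow>
    (\<forall>i j. i < j \<longrightarrow> j < i + 2 * Suc k \<longrightarrow> (r < arc_dist i j \<longleftrightarrow> j = i + Suc k))"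
    (is "?cross \<longleftrightarrow> ?antipodal")
proof
  let ?n = "2 * Suc k"
  have far: "far r a b \<longleftrightarrow> r < arc_dist a b" if "a \<le> b" "b \<le> a + ?n" for a b
    using circle_dist_point[OF that] by auto
  {
    assume cross: ?cross
    have opp: "j = i + Suc k" if ij: "i < j" "j < i + ?n" "far r i j" for i j
    proof -
      have "far r j (i + ?n)" using ij(3) point_shift[of i] circle_dist_commute by metis
      then show ?thesis
        using far_sides[OF cross assms ij] far_sides[OF cross assms, of j "i + ?n"] ij by auto
    qed
    have "far r i (i + Suc k)" for i
    proof -
      obtain y where "y \<in> points" "\<not> circle_dist (point i) y \<le> r"
        using cross point_in_points[of i] unfolding cross_polytope_def by blast
      then obtain l where l: "l \<in> {i..<i + ?n}" "far r i l" using points_window[of i] by auto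
      moreover have "l \<noteq> i" using l(2) far[of i i] assms by (auto simp: arc_dist_def)
      ultimately show ?thesis using opp[of i l] by auto
    qed
    then show ?antipodal using opp far by (metis less_imp_le)
  next
    assume anti: ?antipodal
    show ?cross
      unfolding cross_polytope_def
    proof
      fix x assume "x \<in> points"
      then obtain i where x: "x = point i" using points_window[of 0] by auto
      have "far r i (i + Suc k)" using anti far[of i "i + Suc k"] by auto
      moreover have "y = point (i + Suc k)" if y: "y \<in> points" "\<not> circle_dist x y \<le> r" for y
      proof -
        obtain l where l: "l \<in> {i..<i + ?n}" "y = point l" using y(1) points_window[of i] by auto
        have "l \<noteq> i" using y(2) l(2) x far[of i i] assms by (auto simp: arc_dist_def)
        then have "l = i + Suc k" using anti far[of i l] y(2) l x by auto
        then show ?thesis using l(2) by simp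
      qed
      ultimately show "\<exists>!y. y \<in> points \<and> \<not> circle_dist x y \<le> r"
        using x point_in_points by blast
    qed
  }
qed

lemma arcs_bounds:
  assumes "1 \<le> k" "0 \<le> tb" "tb < td"
    and cross: "\<And>r. 0 \<le> r \<Longrightarrow>
      cross_polytope (\<lambda>x y. circle_dist x y \<le> r) points \<longleftrightarrow> tb \<le> r \<and> r < td"
  shows "X (i + k) - X i \<le> tb" "td \<le> pi" "\<exists>i. 2 * pi - td \<le> X (i + Suc k) - X i"
proof -
  let ?n = "2 * Suc k"
  have anti: "r < arc_dist i j \<longleftrightarrow> j = i + Suc k"
    if "tb \<le> r" "r < td" "i < j" "j < i + ?n" for r i j
    using cross[of r] cross_polytope_points_iff[of r] that assms by auto
  have near: "arc_dist i j \<le> tb" if "i < j" "j < i + ?n" "j \<noteq> i + Suc k" for i j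
    using anti[of tb i j] that assms by auto
  have opp: "td \<le> arc_dist i (i + Suc k)" for i
  proof (rule ccontr)
    assume "\<not> td \<le> arc_dist i (i + Suc k)"
    \<comment> \<open>This radius lies in \<open>[tb, td)\<close> but is not below the distance of
      the opposite pair.\<close>
    then show False using anti[of "max tb (arc_dist i (i + Suc k))" i "i + Suc k"] assms by auto
  qed
  show "td \<le> pi" using opp[of 0] arc_dist_le_pi[of 0 "0 + Suc k"] by linarith
  show "X (i + k) - X i \<le> tb"
  proof -
    \<comment> \<open>The complementary arc contains an arc between opposite points, of length at
      least \<open>td > tb\<close>, so it cannot be the short one.\<close>
    have "X (i + k + Suc k) < X (i + ?n)" by (intro X_strict_mono) auto
    then show ?thesis
      using near[of i "i + k"] opp[of "i + k"] assms period[of i] by (auto simp: arc_dist_def min_def split: if_splits)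
  qed
  \<comment> \<open>At radius \<open>td\<close> the matching fails. Non-opposite pairs are still
    close, so some opposite pair has distance at most \<open>td\<close>.\<close>
  have "\<not> cross_polytope (\<lambda>x y. circle_dist x y \<le> td) points" using cross[of td] assms by auto
  then obtain i j where ij: "i < j" "j < i + ?n" "\<not> (td < arc_dist i j \<longleftrightarrow> j = i + Suc k)"
    using cross_polytope_points_iff[of td] assms by auto
  then have "arc_dist i (i + Suc k) \<le> td" using near[of i j] assms by auto
  then show "\<exists>i. 2 * pi - td \<le> X (i + Suc k) - X i"
  proof (cases "X (i + Suc k) - X i \<le> td")
    case True
    \<comment> \<open>If the arc starting at \<open>i\<close> is the short one, the long one starts
      at the opposite point.\<close>
    have "i + Suc k + Suc k = i + ?n" by simp
    then have "X (i + Suc k + Suc k) = X i + 2 * pi" using period[of i] by metis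
    then show ?thesis using True by (intro exI[of _ "i + Suc k"]) simp
  qed (auto simp: arc_dist_def min_def intro!: exI[of _ i] split: if_splits)
qed

text \<open>Two points that are not opposite are at most \<open>k\<close> steps apart in one of the
  two directions. The equalities at index \<open>0\<close> make both ends of the interval
  sharp.\<close>

lemma cross_polytope_interval:
  assumes "1 \<le> k" "0 \<le> tb" "tb < td" "td \<le> pi"
    and "\<And>i. X (i + k) - X i \<le> tb" "X k - X 0 = tb"
    and opp: "\<And>i. \<bar>X (i + Suc k) - X i - pi\<bar> \<le> pi - td" and "X (Suc k) - X 0 = 2 * pi - td"
    and "0 \<le> r"
  shows "cross_polytope (\<lambda>x y. circle_dist x y \<le> r) points \<longleftrightarrow> tb \<le> r \<and> r < td"
proof
  let ?n = "2 * Suc k"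
  assume "cross_polytope (\<lambda>x y. circle_dist x y \<le> r) points"
  then have anti: "i < j \<Longrightarrow> j < i + ?n \<Longrightarrow> r < arc_dist i j \<longleftrightarrow> j = i + Suc k" for i j
    using cross_polytope_points_iff[OF assms(9)] by blast
  show "tb \<le> r \<and> r < td"
    using anti[of 0 k] anti[of 0 "Suc k"] assms by (auto simp: arc_dist_def)
next
  let ?n = "2 * Suc k"
  assume r: "tb \<le> r \<and> r < td"
  have "r < arc_dist i j \<longleftrightarrow> j = i + Suc k" if ij: "i < j" "j < i + ?n" for i j
  proof (cases "j = i + Suc k")
    case True
    then show ?thesis using opp[of i] r by (auto simp: arc_dist_def)
  next
    case False
    then consider "j \<le> i + k" | "i + ?n \<le> j + k" using ij by (cases "j \<le> i + k") auto
    then have "arc_dist i j \<le> tb"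
    proof cases
      case 1
      then show ?thesis using X_mono[OF 1] assms(5)[of i] by (auto simp: arc_dist_def)
    next
      case 2
      then show ?thesis using X_mono[OF 2] assms(5)[of j] period[of i] by (auto simp: arc_dist_def)
    qed
    then show ?thesis using r False by auto
  qed
  then show "cross_polytope (\<lambda>x y. circle_dist x y \<le> r) points"
    using cross_polytope_points_iff[OF assms(9)] by blast
qed

text \<open>Walking around the circle in steps of \<open>k\<close> points: \<open>2k + 2\<close> steps make \<open>k\<close> turns, and, \<open>k\<close>
  being odd, \<open>k + 1\<close> steps make \<open>(k - 1) / 2\<close> turns and lead to the opposite point.\<close>

lemma walk_bounds:
  fixes tb :: real
  assumes "odd k" and short: "\<And>i. X (i + k) - X i \<le> tb"
  shows "real k / real (k + 1) * pi \<le> tb"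
    "X (i + Suc k) - X i + (real k - 1) * pi \<le> real (k + 1) * tb"
proof -
  have walk: "X (i + m * k) - X i \<le> m * tb" for i m
  proof (induction m)
    case (Suc m)
    have "i + Suc m * k = (i + m * k) + k" by simp
    then show ?case using Suc short[of "i + m * k"] by (simp add: algebra_simps)
  qed simp
  have "2 * pi * k \<le> 2 * Suc k * tb"
    using walk[of 0 "2 * Suc k"] period_mult[of 0 k] by (simp add: mult.commute)
  then have "pi * k \<le> real (k + 1) * tb" by (simp add: algebra_simps)
  then show "real k / real (k + 1) * pi \<le> tb" by (simp add: field_simps)
  obtain h where h: "k = 2 * h + 1" using assms(1) by (rule oddE)
  have "i + Suc k * k = i + Suc k + h * (2 * Suc k)" by (simp add: h algebra_simps)
  then show "X (i + Suc k) - X i + (real k - 1) * pi \<le> real (k + 1) * tb"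
    using walk[of i "Suc k"] period_mult[of "i + Suc k" h] h by (simp add: algebra_simps)
qed

end

text \<open>The sorted list of the points is continued periodically, with a full turn added at each
  pass.\<close>

lemma circle_points_exist:
  assumes "Y \<subseteq> circle" "finite Y" "card Y = n" "0 < n"
  shows "\<exists>X. circle_points n X \<and> Y = X ` {..<n}"
proof -
  define ys where "ys = sorted_list_of_set Y"
  have ys: "length ys = n" "set ys = Y" "sorted_wrt (<) ys"
    using assms by (auto simp: ys_def)
  have mem: "ys ! i \<in> circle" if "i < n" for i using that ys assms(1) nth_mem by blast
  define X where "X i = ys ! (i mod n) + 2 * pi * (i div n)" for i
  have "circle_points n X"
  proof
    fix i
    show "X i < X (Suc i)"
    proof (cases "Suc (i mod n) = n")
      case True
      have "ys ! (i mod n) < 2 * pi" "0 \<le> ys ! 0"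
        using mem[of "i mod n"] mem[of 0] assms(4) by (auto simp: circle_def)
      then show ?thesis using True by (simp add: X_def mod_Suc div_Suc algebra_simps)
    next
      case False
      then have "Suc (i mod n) < n" using assms(4) by (metis Suc_lessI mod_less_divisor)
      then have "ys ! (i mod n) < ys ! Suc (i mod n)"
        using sorted_wrt_nth_less[OF ys(3)] ys(1) by simp
      then show ?thesis using False by (simp add: X_def mod_Suc div_Suc)
    qed
    show "X (i + n) = X i + 2 * pi" using assms(4) by (simp add: X_def algebra_simps)
    show "X i \<in> circle" if "i < n" using mem[OF that] that by (simp add: X_def)
  qed (rule assms(4))
  moreover have "X ` {..<n} = (\<lambda>i. ys ! i) ` {..<n}" by (rule image_cong) (auto simp: X_def)
  then have "Y = X ` {..<n}" using ys by (auto simp: set_conv_nth)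
  ultimately show ?thesis by blast
qed

section \<open>The extremal configurations\<close>

text \<open>The extremal configuration: evenly spaced points, with the diameters through them tilted
  alternately (parameter \<open>e = pi - td\<close>, moving the diameter from \<open>X 0\<close> to \<open>X (k + 1)\<close> most), and
  stretched so that the arc from \<open>X 0\<close> to \<open>X k\<close> has length \<open>tb\<close> (parameter \<open>f\<close>).\<close>

definition tilted_points :: "nat \<Rightarrow> real \<Rightarrow> real \<Rightarrow> nat \<Rightarrow> real" where
  "tilted_points k e f i =
     real i * pi / real (Suc k) + f * real (i mod Suc k) / real k + e / 2
       - e * (- 1) ^ (i div Suc k + i mod Suc k) * (1 / 2 - real (i mod Suc k) / real (Suc k))"

lemma tilted_points_eq:
  assumes "m \<le> k"
  shows "tilted_points k e f (q * Suc k + m) =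
     real q * pi + real m * pi / real (Suc k) + f * real m / real k + e / 2
       - e * (- 1) ^ (q + m) * (1 / 2 - real m / real (Suc k))"
proof -
  have *: "(q * Suc k + m) div Suc k = q" "(q * Suc k + m) mod Suc k = m"
    using assms by (simp_all del: mult_Suc_right)
  have "real (q * Suc k + m) * pi / real (Suc k) = real q * pi + real m * pi / real (Suc k)"
    by (simp add: field_simps)
  then show ?thesis unfolding tilted_points_def * by simp
qed

text \<open>With \<open>td = pi - e\<close> and \<open>tb = (k * pi + e) / Suc k + f\<close>, the
  assumption \<open>gap\<close> says that \<open>tb < td\<close>.\<close>

context
  fixes k :: nat and e f :: real
  assumes odd: "odd k" and e: "0 \<le> e" and f: "0 \<le> f"
    and gap: "f + e * (real k + 2) / real (Suc k) < pi / real (Suc k)"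
begin

private abbreviation "X \<equiv> tilted_points k e f"
private abbreviation "K \<equiv> real (Suc k)"

private lemma index: obtains q m where "i = q * Suc k + m" "m \<le> k"
  using that[of "i div Suc k" "i mod Suc k"] by (metis div_mult_mod_eq less_Suc_eq_le mod_less_divisor zero_less_Suc)

private lemma sign_bound: "\<bar>x\<bar> \<le> b \<Longrightarrow> e * (- 1) ^ j * x \<le> e * b \<and> - (e * b) \<le> e * (- 1) ^ j * x"
  for x b :: real
proof -
  assume "\<bar>x\<bar> \<le> b"
  then have "\<bar>e * (- 1) ^ j * x\<bar> \<le> e * b" using e by (simp add: abs_mult mult_left_mono)
  then show ?thesis by linarith
qed

private lemma k_pos: "0 < real k"
  using odd by (simp add: odd_pos)

text \<open>The stretching widens the spacings within a block of \<open>k + 1\<close> points and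
  narrows the step into the next block by \<open>f\<close>. The tilt changes a spacing by at most
  \<open>e * k / (k + 1)\<close>.\<close>

lemma tilted_points_step: "X i < X (Suc i)"
proof -
  obtain q m where i: "i = q * Suc k + m" "m \<le> k" by (rule index)
  have small: "f + e * (k / K) < pi / K"
  proof -
    have "e * (k / K) \<le> e * (real k + 2) / K" using e by (simp add: divide_right_mono mult_left_mono)
    then show ?thesis using gap by linarith
  qed
  show ?thesis
  proof (cases "m = k")
    case False
    then have m: "Suc m \<le> k" using i by simp
    have "\<bar>1 - (2 * real m + 1) / K\<bar> \<le> k / K"
    proof -
      have "1 - (2 * real m + 1) / K = (real k - 2 * real m) / K" by (simp add: field_simps)
      moreover have "\<bar>real k - 2 * real m\<bar> \<le> k" using m by linarith
      ultimately show ?thesis by (simp add: abs_divide divide_right_mono)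
    qed
    note b = sign_bound[OF this, of "q + m"]
    have "X (Suc i) - X i = pi / K + f / k + e * (- 1) ^ (q + m) * (1 - (2 * real m + 1) / K)"
      using tilted_points_eq[OF i(2), of e f q] tilted_points_eq[OF m, of e f q] i(1)
      by (simp add: add_divide_distrib diff_divide_distrib ring_distribs)
    moreover have "0 \<le> f / k" using f by simp
    ultimately show ?thesis using b small f by linarith
  next
    case True
    have "\<bar>k / K\<bar> \<le> k / K" by simp
    note b = sign_bound[OF this, of "Suc q"]
    \<comment> \<open>As \<open>k\<close> is odd, the last point of a block and the first of the
      next have the same tilt sign.\<close>
    have s: "(- 1) ^ (q + k) = - ((- 1) ^ q :: real)" using odd by (simp add: power_add)
    have i': "Suc i = Suc q * Suc k + 0" "i = q * Suc k + k" using i True by simp_all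
    have "X (Suc i) - X i = pi - k * pi / K - f - e * (- 1) ^ Suc q * (k / K)"
      using k_pos unfolding i'(1) unfolding i'(2) tilted_points_eq[OF le0] tilted_points_eq[OF le_refl] s
      by (simp add: ring_distribs)
    moreover have "pi - k * pi / K = pi / K" by (simp add: field_simps)
    ultimately show ?thesis using b small by linarith
  qed
qed

lemma tilted_points_period: "X (i + 2 * Suc k) = X i + 2 * pi"
proof -
  obtain q m where i: "i = q * Suc k + m" "m \<le> k" by (rule index)
  have "i + 2 * Suc k = (q + 2) * Suc k + m" using i by simp
  then show ?thesis unfolding i(1) by (simp only: tilted_points_eq[OF i(2)]) (simp add: ring_distribs)
qed

lemma tilted_points_0: "X 0 = 0"
  by (simp add: tilted_points_def)

text \<open>Passing to the opposite point reverses the tilt sign, so the deviation from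
  \<open>pi\<close> is twice the tilt, largest at \<open>m = 0\<close>.\<close>

lemma tilted_points_opposite:
  "\<bar>X (i + Suc k) - X i - pi\<bar> \<le> e" "X (Suc k) - X 0 = pi + e"
proof -
  obtain q m where i: "i = q * Suc k + m" "m \<le> k" by (rule index)
  have *: "i + Suc k = Suc q * Suc k + m" using i by simp
  have "\<bar>1 - 2 * m / K\<bar> \<le> 1" using i by (simp add: abs_le_iff field_simps)
  note b = sign_bound[OF this, of "q + m"]
  have "X (i + Suc k) - X i = pi + e * (- 1) ^ (q + m) * (1 - 2 * m / K)"
    unfolding * unfolding i(1) tilted_points_eq[OF i(2)]
    by (simp add: ring_distribs)
  then show "\<bar>X (i + Suc k) - X i - pi\<bar> \<le> e" using b by (simp add: abs_le_iff)
  show "X (Suc k) - X 0 = pi + e"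
    using tilted_points_eq[of 0 k e f 1] by (simp add: tilted_points_0)
qed

text \<open>From the first point of a block, \<open>k\<close> steps stay in it and collect the full
  stretching \<open>f\<close>. From any other point they end in the next block, one position
  earlier, and lose \<open>f / k\<close>.\<close>

lemma tilted_points_near:
  "X (i + k) - X i \<le> (k * pi + e) / K + f" "X k - X 0 = (k * pi + e) / K + f"
proof -
  obtain q m where i: "i = q * Suc k + m" "m \<le> k" by (rule index)
  have first: "X (q * Suc k + k) - X (q * Suc k + 0) = k * pi / K + f + e * (- 1) ^ q * (1 / K)" for q
  proof -
    have s: "(- 1) ^ (q + k) = - ((- 1) ^ q :: real)" using odd by (simp add: power_add)
    have K: "k / K = 1 - 1 / K" by (simp add: field_simps)
    show ?thesis using k_pos unfolding tilted_points_eq[OF le0] tilted_points_eq[OF le_refl] s K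
      by (simp add: ring_distribs)
  qed
  have "\<bar>1 / K\<bar> \<le> 1 / K" by simp
  note b = sign_bound[OF this]
  show "X (i + k) - X i \<le> (k * pi + e) / K + f"
  proof (cases m)
    case 0
    then show ?thesis using first[of q] b[of q] i by (simp add: add_divide_distrib)
  next
    case (Suc l)
    have *: "i + k = Suc q * Suc k + l" using i Suc by simp
    have l: "l \<le> k" using i Suc by simp
    have "X (i + k) - X i = pi - pi / K - f / k - e * (- 1) ^ (q + m) * (1 / K)"
      unfolding * unfolding i(1) tilted_points_eq[OF i(2)] tilted_points_eq[OF l]
      by (simp add: Suc ring_distribs add_divide_distrib)
    moreover have "pi - pi / K = k * pi / K" by (simp add: field_simps)
    moreover have "0 \<le> f / k" using f by simp
    moreover have "(k * pi + e) / K = k * pi / K + e * (1 / K)" by (simp add: add_divide_distrib)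
    ultimately show ?thesis using b[of "q + m"] f by linarith
  qed
  show "X k - X 0 = (k * pi + e) / K + f" using first[of 0] by (simp add: add_divide_distrib)
qed

lemma tilted_points_circle: "circle_points (2 * Suc k) X"
proof
  have mono: "i \<le> j \<Longrightarrow> X i \<le> X j" for i j
    using lift_Suc_mono_le[of X] tilted_points_step less_imp_le by blast
  show "X i \<in> circle" if "i < 2 * Suc k" for i
    using mono[of 0 i] mono[of "Suc i" "0 + 2 * Suc k"] tilted_points_step[of i]
      tilted_points_period[of 0] that by (auto simp: circle_def tilted_points_0)
qed (simp_all add: tilted_points_step tilted_points_period del: mult_Suc_right)

end

section \<open>The principal persistence set\<close>

theorem theorem5p6:
  fixes k :: nat
  assumes "odd k" and "k \<ge> 1"
  shows "principal_persistence_set TYPE('f::field) k circle_dist circle =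
    {(tb, td). real (k + 1) * (pi - tb) \<le> td \<and>
       real k / real (k + 1) * pi \<le> tb \<and> tb < td \<and> td \<le> pi}"
proof -
  have dgm: "has_dgm (VR_module k circle_dist Y :: ('f, (real set \<Rightarrow>\<^sub>0 'f) set) pers_module) {#(tb, td)#} \<longleftrightarrow>
    0 \<le> tb \<and> tb < td \<and>
    (\<forall>r\<ge>0. card Y = 2 * Suc k \<and> cross_polytope (\<lambda>x y. circle_dist x y \<le> r) Y \<longleftrightarrow> tb \<le> r \<and> r < td)"
    if "finite Y" "card Y \<le> 2 * Suc k" for Y tb td
    using that by (intro has_dgm_VR_iff) (auto simp: circle_dist_def abs_minus_commute)
  have "real (k + 1) * (pi - tb) \<le> td \<and> real k / real (k + 1) * pi \<le> tb \<and> tb < td \<and> td \<le> pi"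
    if Y: "Y \<subseteq> circle" "finite Y" "card Y \<le> 2 * k + 2"
      and "has_dgm (VR_module k circle_dist Y :: ('f, (real set \<Rightarrow>\<^sub>0 'f) set) pers_module) {#(tb, td)#}" for Y tb td
  proof -
    have t: "0 \<le> tb" "tb < td"
      and cross: "\<And>r. 0 \<le> r \<Longrightarrow>
        card Y = 2 * Suc k \<and> cross_polytope (\<lambda>x y. circle_dist x y \<le> r) Y \<longleftrightarrow> tb \<le> r \<and> r < td"
      using that dgm[OF Y(2), of tb td] by auto
    \<comment> \<open>The interval contains \<open>tb\<close>, so \<open>Y\<close> has the full
      number of points.\<close>
    have card: "card Y = 2 * Suc k" using cross[of tb] t by auto
    obtain X where X: "circle_points (2 * Suc k) X" "Y = X ` {..<2 * Suc k}"
      using circle_points_exist[OF Y(1,2) card] by auto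
    interpret circle_points_even k X unfolding circle_points_even_def by (rule X(1))
    have points: "Y = points" unfolding points_def by (rule X(2))
    note b = arcs_bounds[OF assms(2) t, unfolded points[symmetric]]
    have short: "X (i + k) - X i \<le> tb" for i using b(1) cross card by blast
    have td: "td \<le> pi" using b(2) cross card by blast
    \<comment> \<open>This long arc, inserted into the walk by \<open>k + 1\<close> steps, gives the
      first inequality.\<close>
    obtain i where "2 * pi - td \<le> X (i + Suc k) - X i" using b(3) cross card by blast
    then have "2 * pi - td + (real k - 1) * pi \<le> real (k + 1) * tb"
      using walk_bounds(2)[OF assms(1) short, of i] by linarith
    then show ?thesis using t td walk_bounds(1)[OF assms(1) short] by (simp add: algebra_simps)
  qed
  moreover have "\<exists>Y. Y \<subseteq> circle \<and> finite Y \<and> card Y \<le> 2 * k + 2 \<and>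
      has_dgm (VR_module k circle_dist Y :: ('f, (real set \<Rightarrow>\<^sub>0 'f) set) pers_module) {#(tb, td)#}"
    if t: "real (k + 1) * (pi - tb) \<le> td" "real k / real (k + 1) * pi \<le> tb" "tb < td" "td \<le> pi" for tb td
  proof -
    define e where "e = pi - td"
    \<comment> \<open>What remains of \<open>tb\<close> beyond the length that the tilt alone
      produces; \<open>0 \<le> f\<close> is the first inequality.\<close>
    define f where "f = tb - (k * pi + e) / real (Suc k)"
    have e: "0 \<le> e" using t by (simp add: e_def)
    have f: "0 \<le> f" using t(1) by (simp add: f_def e_def field_simps)
    have gap: "f + e * (real k + 2) / real (Suc k) < pi / real (Suc k)"
    proof -
      have "k * pi / real (Suc k) = pi - pi / real (Suc k)" by (simp add: field_simps)
      then have "(k * pi + e) / real (Suc k) = pi - pi / real (Suc k) + e / real (Suc k)"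
        by (simp only: add_divide_distrib)
      moreover have "e * (real k + 2) / real (Suc k) = e + e / real (Suc k)"
        by (simp add: field_simps)
      ultimately show ?thesis using t(3) f_def e_def by linarith
    qed
    have "0 \<le> real k / real (k + 1) * pi" by simp
    then have "0 \<le> tb" using t(2) by linarith
    let ?X = "tilted_points k e f"
    interpret circle_points_even k ?X
      unfolding circle_points_even_def by (rule tilted_points_circle[OF assms(1) e f gap])
    have "cross_polytope (\<lambda>x y. circle_dist x y \<le> r) points \<longleftrightarrow> tb \<le> r \<and> r < td" if "0 \<le> r" for r
      using tilted_points_near[OF assms(1) e f gap] tilted_points_opposite[OF assms(1) e f gap]
      by (intro cross_polytope_interval) (use assms(2) \<open>0 \<le> tb\<close> t that in \<open>auto simp: f_def e_def\<close>)
    then have "has_dgm (VR_module k circle_dist points :: ('f, (real set \<Rightarrow>\<^sub>0 'f) set) pers_module) {#(tb, td)#}"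
      using dgm[OF finite_points] card_points t(3) \<open>0 \<le> tb\<close> by simp
    then show ?thesis using points_subset finite_points card_points by (intro exI[of _ points]) simp
  qed
  ultimately show ?thesis unfolding principal_persistence_set_def by blast
qed

end
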